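(* Let $W$ be a centered real-valued random variable such that $\mathbb{E}[|W|^3]\le M\cdot \mathbb{E}[W^2]<\infty$ for some $M>0$. Then, for any positive integer $n$ and independent copies $W_1,\dots,W_n$ of $W$, \[ \mathbb{P}\!\left(\frac1n\sum_{i=1}^n W_i \le \frac{2M}{n}\right)\ge \frac12 . \] In particular, the assumption (and hence the conclusion) holds whenever $W$ is centered and $|W|\le M$ almost surely. *)

theory Defs
  imports "HOL-Probability.Probability"
begin

end

theory Submission
  imports Defs "HOL-Real_Asymp.Real_Asymp"
begin

text \<open>
  After rescaling \<open>W\<close> to \<open>3 W / (4 M)\<close> one has to show \<open>P(S > 3/2) \<le> 1/2\<close> for a sum \<open>S\<close> of
  independent copies, where \<open>E |W|^3 \<le> 3/4 E W^2\<close>. Let \<open>A\<close> be the variance of \<open>S\<close>.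
  If \<open>A \<le> 9/4\<close>, Cantelli's inequality suffices. If \<open>A \<ge> 9/4\<close>, the sign function is
  majorised by Beurling's function, whose Fourier transform is supported on a bounded interval,
  so that \<open>\<pi> (2 P(S > 3/2) - 1)\<close> is at most an integral over \<open>{0..\<pi>}\<close> of the characteristic
  function of \<open>S\<close> against an explicit weight. Near \<open>0\<close> the characteristic function is compared
  with the Gaussian one, whose contribution is negative because the point \<open>3/2\<close> exceeds the shift
  caused by the smoothing; this gain outweighs the third moment error. Farther away the decay of the
  characteristic function is enough. Cutting the frequencies at \<open>\<pi>\<close> in this scaling balances
  the smoothing loss against the range on which the third moment controls the characteristic function.
\<close>

section \<open>Trigonometric inequalities\<close>

text \<open>Large n gives no asymptotic help. The gain from the point 3/2 and the loss from the
  third moment are both of order 1 / sqrt A, so constants alone decide: with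
  \<open>r = sqrt A\<close>, the gain \<open>1253/1000 / r\<close> faces the loss
  \<open>315/512 * (14013/10000 / r)\<close>. For A near 9/4 the exponential terms matter as well.
  This is why the elementary estimates carry nearly optimal constants, such as 1/10 in
  \<open>cos_le_cubic\<close>, and why the smoothing weight is bounded by 21/10 / p where its
  leading term is 2 / p. The shift is visible in that weight: near p = 0 it behaves like (2 / p) exp
  (- i (c - 1) p), so a point c acts like c - 1, and at c = 3/2 half a unit survives. The comparison
  with the Gaussian needs \<open>K * u \<le> 1\<close>; for K = 3/4 this is u \<le> 4/3, the first
  cut in the frequency range.\<close>

lemma abs_sin_diff_le: "\<bar>sin x - x\<bar> \<le> \<bar>x\<bar> ^ 3 / 6" for x :: real
  using Maclaurin_sin_bound[of x 3] by (simp add: sin_coeff_def eval_nat_numeral)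

lemma cos_ge_quadratic: "1 - x\<^sup>2 / 2 \<le> cos x" for x :: real
proof -
  obtain t where "cos x = (\<Sum>m<2. cos_coeff m * x ^ m) + cos (t + 1/2 * real 2 * pi) / fact 2 * x ^ 2"
    using Maclaurin_cos_expansion[of x 2] by blast
  moreover have "cos (t + pi) * x\<^sup>2 \<ge> -1 * x\<^sup>2"
    by (rule mult_right_mono) auto
  ultimately show ?thesis by (simp add: cos_coeff_def eval_nat_numeral)
qed

lemma cos_le_quartic: "cos x \<le> 1 - x\<^sup>2 / 2 + x ^ 4 / 24" for x :: real
proof -
  obtain t where "cos x = (\<Sum>m<4. cos_coeff m * x ^ m) + cos (t + 1/2 * real 4 * pi) / fact 4 * x ^ 4"
    using Maclaurin_cos_expansion[of x 4] by blast
  moreover have "cos (t + 2 * pi) * x ^ 4 \<le> 1 * x ^ 4"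
    by (rule mult_right_mono) auto
  moreover have "cos_coeff (Suc (Suc (Suc 0))) = 0" by (simp add: cos_coeff_def)
  ultimately show ?thesis by (simp add: cos_coeff_Suc sin_coeff_Suc eval_nat_numeral)
qed

text \<open>The factor 1/10 is almost best possible: at x = 4 the two sides differ by about 0.05.
  The Taylor factor 1/6 would turn the exponent of \<open>norm_char_le\<close> into u^2 / 2 - K u^3
  / 3, which for K = 3/4 is negative beyond u = 2. The quartic bound serves small x, the parabola at
  pi the middle range, and cos x \<le> 1 the rest.\<close>

lemma cos_le_cubic: "cos x \<le> 1 - x\<^sup>2 / 2 + \<bar>x\<bar> ^ 3 / 10" for x :: real
proof -
  have main: "cos x \<le> 1 - x\<^sup>2 / 2 + x ^ 3 / 10" if "x \<ge> 0" for x :: real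
  proof -
    consider "x \<le> 12/5" | "12/5 \<le> x" "x \<le> 5" | "x \<ge> 5" by linarith
    then show ?thesis
    proof cases
      case 1
      have "x ^ 3 * x \<le> x ^ 3 * (12/5)"
        using 1 that by (intro mult_left_mono) auto
      then show ?thesis using cos_le_quartic[of x] by (simp add: eval_nat_numeral)
    next
      case 2
      have "cos x = - cos (x - pi)" by simp
      also have "\<dots> \<le> - (1 - (x - pi)\<^sup>2 / 2)" using cos_ge_quadratic[of "x - pi"] by simp
      also have "\<dots> \<le> 1 - x\<^sup>2 / 2 + x ^ 3 / 10"
      proof -
        have pi: "pi \<ge> (31415/10000)" "pi \<le> (31416/10000)" using pi_approx by auto
        have "pi * pi \<le> (31416/10000) * (31416/10000)" using pi by (intro mult_mono) auto
        moreover have "(31415/10000) * x \<le> pi * x" using pi 2 by (intro mult_right_mono) auto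
        \<comment> \<open>Ten times the required difference is almost a cubic with a double root
          near 413/100. The roots 413/100 (twice) and 174/100 add up to 10, which matches its
          quadratic coefficient.\<close>
        moreover have "0 \<le> (x - (413/100))\<^sup>2 * (x - (174/100))" using 2 by simp
        then have "0 \<le> x ^ 3 - 10 * x\<^sup>2 + (314293/10000) * x - (2967/100)"
          by (simp add: power2_eq_square power3_eq_cube field_simps)
        moreover have "(x - pi)\<^sup>2 = x\<^sup>2 - 2 * (pi * x) + pi * pi"
          by (simp add: power2_eq_square algebra_simps)
        ultimately show ?thesis using 2 by linarith
      qed
      finally show ?thesis .
    next
      case 3
      have "x\<^sup>2 * 5 \<le> x\<^sup>2 * x" using 3 by (intro mult_left_mono) auto
      then have "1 \<le> 1 - x\<^sup>2 / 2 + x ^ 3 / 10" by (simp add: eval_nat_numeral)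
      then show ?thesis using cos_le_one[of x] by linarith
    qed
  qed
  show ?thesis using main[of "\<bar>x\<bar>"] by simp
qed

text \<open>An upper bound for x cot x, multiplied by sin x so that the endpoints cause no trouble.
  The derivative of the difference is y/3 times y cos y - sin y, which decreases from 0.\<close>

lemma x_cos_le:
  fixes x :: real
  assumes "0 \<le> x" "x \<le> pi"
  shows "x * cos x \<le> (1 - x\<^sup>2 / 3) * sin x"
proof -
  have *: "x * cos x - sin x \<le> 0" if "0 \<le> x" "x \<le> pi" for x :: real
  proof -
    have "x * cos x - sin x \<le> 0 * cos 0 - sin 0"
    proof (rule DERIV_nonpos_imp_nonincreasing[of 0 x "\<lambda>x. x * cos x - sin x"])
      fix y assume "0 \<le> y" "y \<le> x"
      then have "- y * sin y \<le> 0" using that by (simp add: sin_ge_zero)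
      then show "\<exists>d. DERIV (\<lambda>x. x * cos x - sin x) y :> d \<and> d \<le> 0"
        by (intro exI[of _ "- y * sin y"]) (auto intro!: derivative_eq_intros)
    qed (use that in auto)
    then show ?thesis by simp
  qed
  let ?f = "\<lambda>x::real. x * cos x - (1 - x\<^sup>2 / 3) * sin x"
  have "?f x \<le> ?f 0"
  proof (rule DERIV_nonpos_imp_nonincreasing[of 0 x ?f])
    fix y assume y: "0 \<le> y" "y \<le> x"
    have "y / 3 * (y * cos y - sin y) \<le> 0"
      using *[of y] y assms by (simp add: mult_nonneg_nonpos)
    moreover have "DERIV ?f y :> y / 3 * (y * cos y - sin y)"
      by (auto intro!: derivative_eq_intros simp: field_simps power2_eq_square)
    ultimately show "\<exists>d. DERIV ?f y :> d \<and> d \<le> 0" by blast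
  qed (use assms in auto)
  then show ?thesis by simp
qed

text \<open>A lower bound for x cot x. The range ends just above pi - 4/3, because
  \<open>norm_beurling_weight_near_pi\<close> uses it at x = pi - p with p \<ge> 4/3.\<close>

lemma x_cos_ge:
  fixes x :: real
  assumes "0 \<le> x" "x \<le> 181/100"
  shows "(1 - x\<^sup>2 / 2) * sin x \<le> x * cos x"
proof -
  let ?f = "\<lambda>x::real. x * cos x - (1 - x\<^sup>2 / 2) * sin x"
  have D: "DERIV ?f y :> y\<^sup>2 / 2 * cos y" for y
    by (auto intro!: derivative_eq_intros simp: field_simps power2_eq_square)
  have pi: "pi \<ge> (31415/10000)" "pi \<le> (31416/10000)" using pi_approx by auto
  show ?thesis
  proof (cases "x \<le> pi / 2")
    case True
    have "?f 0 \<le> ?f x"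
    proof (rule DERIV_nonneg_imp_nondecreasing[of 0 x ?f])
      fix y assume y: "0 \<le> y" "y \<le> x"
      have "0 \<le> y\<^sup>2 / 2 * cos y" using y True by (simp add: cos_ge_zero)
      then show "\<exists>d. DERIV ?f y :> d \<and> 0 \<le> d" using D by blast
    qed (use assms in auto)
    then show ?thesis by simp
  next
    case False
    \<comment> \<open>Beyond pi / 2 the difference decreases, so monotonicity from 0 no longer
      helps; the short remaining range is checked by explicit bounds in y.\<close>
    define y where "y = x - pi / 2"
    have y: "0 \<le> y" "y \<le> (24/100)" using False assms pi by (auto simp: y_def)
    have s: "sin x = cos y" and c: "cos x = - sin y"
      by (simp_all add: y_def cos_diff sin_diff)
    have "x * sin y \<le> (181/100) * y"
      using assms y sin_x_le_x[of y] pi by (intro mult_mono sin_ge_zero) auto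
    have x2: "x\<^sup>2 / 2 - 1 \<ge> (232/1000) + (157/100) * y"
    proof -
      have "((157/100) + y)\<^sup>2 \<le> x\<^sup>2" using pi y by (intro power_mono) (auto simp: y_def)
      then have "(24649/10000) + (314/100) * y + y * y \<le> x\<^sup>2" by (simp add: power2_eq_square algebra_simps)
      moreover have "0 \<le> y * y" by simp
      ultimately show ?thesis by linarith
    qed
    have cy: "cos y \<ge> (97/100)"
    proof -
      have "y\<^sup>2 \<le> (24/100)\<^sup>2" using y by (intro power_mono) auto
      then show ?thesis using cos_ge_quadratic[of y] by (simp add: power2_eq_square)
    qed
    have "((232/1000) + (157/100) * y) * (97/100) \<le> (x\<^sup>2 / 2 - 1) * cos y"
      using x2 cy y by (intro mult_mono) auto
    moreover have "(181/100) * y \<le> ((232/1000) + (157/100) * y) * (97/100)" using y by simp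
    ultimately have "x * sin y \<le> (x\<^sup>2 / 2 - 1) * cos y"
      using \<open>x * sin y \<le> (181/100) * y\<close> by linarith
    then show ?thesis unfolding s c by (simp add: algebra_simps)
  qed
qed

section \<open>Beurling's majorant of the sign function\<close>

text \<open>A polynomial close to f replaces it at a cost of e / 2; for the polynomial, integration
  by parts gains a factor 1 / k.\<close>

lemma Riemann_Lebesgue_sin:
  fixes f :: "real \<Rightarrow> real"
  assumes f: "continuous_on {a..b} f" and "a \<le> b"
  shows "((\<lambda>k. integral {a..b} (\<lambda>x. f x * sin (k * x))) \<longlongrightarrow> 0) at_top"
proof (rule tendstoI)
  fix e :: real assume "e > 0"
  define d where "d = e / (2 * (b - a + 1))"
  have "d > 0" using \<open>e > 0\<close> \<open>a \<le> b\<close> by (simp add: d_def)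
  obtain g where g: "real_polynomial_function g" and fg: "\<And>x. x \<in> {a..b} \<Longrightarrow> \<bar>f x - g x\<bar> < d"
    using Stone_Weierstrass_real_polynomial_function[OF compact_Icc f \<open>d > 0\<close>] by blast
  obtain g' where g': "real_polynomial_function g'" and Dg: "\<And>x. (g has_real_derivative g' x) (at x)"
    using has_real_derivative_polynomial_function[OF g] by blast
  have cont: "continuous_on S g" "continuous_on S g'" for S
    using g g' by (auto intro: continuous_on_polymonial_function simp: real_polynomial_function_eq)
  have bdd: "\<exists>B. \<forall>x\<in>{a..b}. \<bar>h x\<bar> \<le> B" if "continuous_on {a..b} h" for h :: "real \<Rightarrow> real"
    using compact_imp_bounded[OF compact_continuous_image[OF that compact_Icc]]
    by (auto simp: bounded_iff)
  obtain B where B: "\<And>x. x \<in> {a..b} \<Longrightarrow> \<bar>g x\<bar> \<le> B" using bdd[OF cont(1)] by blast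
  obtain B' where B': "\<And>x. x \<in> {a..b} \<Longrightarrow> \<bar>g' x\<bar> \<le> B'" using bdd[OF cont(2)] by blast
  define C where "C = 2 * B + B' * (b - a)"
  have "\<forall>\<^sub>F k in at_top. C / k < e / 2" using \<open>e > 0\<close> by real_asymp
  then have "\<forall>\<^sub>F k in at_top. k > 0 \<and> C / k < e / 2" using eventually_gt_at_top[of 0] by eventually_elim auto
  then show "\<forall>\<^sub>F k in at_top. dist (integral {a..b} (\<lambda>x. f x * sin (k * x))) 0 < e"
  proof eventually_elim
    case (elim k)
    let ?F = "\<lambda>x. - (g x * cos (k * x)) / k"
    have "((\<lambda>x. g x * sin (k * x) - g' x * cos (k * x) / k) has_integral ?F b - ?F a) {a..b}"
      using elim \<open>a \<le> b\<close>
      by (intro fundamental_theorem_of_calculus)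
         (auto intro!: derivative_eq_intros DERIV_subset[OF Dg] Dg simp: field_simps
               has_real_derivative_iff_has_vector_derivative[symmetric])
    moreover have i2: "(\<lambda>x. g' x * cos (k * x) / k) integrable_on {a..b}"
      by (intro integrable_continuous_interval continuous_intros cont) (use elim in auto)
    moreover have i1: "(\<lambda>x. g x * sin (k * x)) integrable_on {a..b}"
      by (intro integrable_continuous_interval continuous_intros cont)
    ultimately have "integral {a..b} (\<lambda>x. g x * sin (k * x)) = ?F b - ?F a + integral {a..b} (\<lambda>x. g' x * cos (k * x) / k)"
      by (simp add: has_integral_iff integral_diff)
    moreover have "\<bar>?F b\<bar> \<le> B / k" "\<bar>?F a\<bar> \<le> B / k"
      using elim \<open>a \<le> b\<close> B[of a] B[of b] mult_mono[OF B abs_cos_le_one, of b "k * b"]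
        mult_mono[OF B abs_cos_le_one, of a "k * a"]
      by (auto simp: abs_mult divide_right_mono)
    moreover have "\<bar>integral {a..b} (\<lambda>x. g' x * cos (k * x) / k)\<bar> \<le> B' / k * (b - a)"
    proof -
      have "\<bar>g' x * cos (k * x) / k\<bar> \<le> B' / k" if "x \<in> {a..b}" for x
        using elim B'[OF that] mult_mono[OF B'[OF that] abs_cos_le_one, of "k * x"]
        by (auto simp: abs_mult divide_right_mono)
      moreover have "continuous_on {a..b} (\<lambda>x. g' x * cos (k * x) / k)"
        using elim by (intro continuous_intros cont) auto
      ultimately show ?thesis
        using integral_bound[OF \<open>a \<le> b\<close>, of "\<lambda>x. g' x * cos (k * x) / k" "B' / k"]
        unfolding real_norm_def by blast
    qed
    ultimately have 1: "\<bar>integral {a..b} (\<lambda>x. g x * sin (k * x))\<bar> \<le> C / k"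
      unfolding C_def add_divide_distrib times_divide_eq_left by linarith
    have i3: "(\<lambda>x. f x * sin (k * x)) integrable_on {a..b}"
      by (intro integrable_continuous_interval continuous_intros f)
    have 2: "\<bar>integral {a..b} (\<lambda>x. f x * sin (k * x) - g x * sin (k * x))\<bar> \<le> d * (b - a)"
    proof -
      have "\<bar>f x * sin (k * x) - g x * sin (k * x)\<bar> \<le> d" if "x \<in> {a..b}" for x
        using mult_mono[of "\<bar>f x - g x\<bar>" d "\<bar>sin (k * x)\<bar>" 1] fg[OF that] \<open>d > 0\<close>
        by (simp add: left_diff_distrib[symmetric] abs_mult)
      moreover have "continuous_on {a..b} (\<lambda>x. f x * sin (k * x) - g x * sin (k * x))"
        by (intro continuous_intros cont f)
      ultimately show ?thesis
        using integral_bound[OF \<open>a \<le> b\<close>, of "\<lambda>x. f x * sin (k * x) - g x * sin (k * x)" d]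
        unfolding real_norm_def by blast
    qed
    have "d * (b - a) \<le> e / 2" using \<open>e > 0\<close> \<open>a \<le> b\<close> by (simp add: d_def field_simps)
    then have "\<bar>integral {a..b} (\<lambda>x. f x * sin (k * x))\<bar> < e"
      using 1 2 elim unfolding integral_diff[OF i3 i1] by linarith
    then show ?case by simp
  qed
qed

text \<open>
  The quotient by \<open>sin p\<close> takes the junk value \<open>0\<close> at the endpoints \<open>0\<close> and \<open>\<pi>\<close>, so pointwise identities
  below are stated on the open interval.
\<close>

definition beurling_kernel :: "real \<Rightarrow> real \<Rightarrow> real" where
  "beurling_kernel y p = 2 * (1 - p / pi) * (sin ((1 + 2 * y) * p) / sin p)"

lemma inverse_square_telescope:
  fixes x :: real
  assumes "x > 0"
  shows "1 / (x + 1)\<^sup>2 \<le> 1 / x - 1 / (x + 1)" "1 / x - 1 / (x + 1) \<le> 1 / x\<^sup>2"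
proof -
  have eq: "1 / x - 1 / (x + 1) = 1 / (x * (x + 1))" using assms by (simp add: field_simps)
  show "1 / (x + 1)\<^sup>2 \<le> 1 / x - 1 / (x + 1)" "1 / x - 1 / (x + 1) \<le> 1 / x\<^sup>2"
    unfolding eq power2_eq_square using assms by (intro divide_left_mono mult_mono mult_pos_pos; simp)+
qed

text \<open>The factor 1 - p / pi cancels the zero of sin at pi, so the only singularity of 2 (1 - p
  / pi) / sin p is 2 / p at 0. Splitting it off leaves a continuous \<open>r\<close>: the first part
  integrates to a sine integral, the second is treated by
  \<open>Riemann_Lebesgue_sin\<close>.\<close>

lemma beurling_kernel_sinc_decomposition:
  "\<exists>r :: real \<Rightarrow> real. continuous_on {0..pi} r \<and>
     (\<forall>p\<in>{0<..<pi}. \<forall>y. beurling_kernel y p = 2 * ((1 + 2 * y) * sinc ((1 + 2 * y) * p)) + r p * sin ((1 + 2 * y) * p))"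
proof -
  define r0 :: "real \<Rightarrow> real" where "r0 = (\<lambda>p. 2 * (1 - p / pi) / sin p - 2 / p)"
  \<comment> \<open>The endpoint values are the one-sided limits of \<open>r0\<close>, whose own
    values there come from division by zero.\<close>
  define r where "r = (\<lambda>p. if p = 0 then - (2 * inverse pi) else if p = pi then 0 else r0 p)"
  have l0: "(r0 \<longlongrightarrow> - (2 * inverse pi)) (at_right 0)"
    unfolding r0_def by real_asymp
  have "((\<lambda>h. 2 * (h / pi) / sin h - 2 / (pi - h)) \<longlongrightarrow> 0) (at_right 0)"
    by real_asymp
  moreover have "filterlim (\<lambda>p. pi - p) (at_right 0) (at_left pi)"
    by (auto simp: filterlim_at eventually_at_filter intro!: tendsto_eq_intros)
  ultimately have "((\<lambda>p. 2 * ((pi - p) / pi) / sin (pi - p) - 2 / (pi - (pi - p))) \<longlongrightarrow> 0) (at_left pi)"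
    by (rule filterlim_compose)
  then have l1: "(r0 \<longlongrightarrow> 0) (at_left pi)"
    by (simp add: r0_def diff_divide_distrib)
  have "continuous_on {0..pi} r"
  proof (rule continuous_on_IccI)
    have "\<forall>\<^sub>F x in at_right 0. r0 x = r x" by (rule eventually_at_rightI[of 0 pi]) (auto simp: r_def)
    moreover have "r 0 = - (2 * inverse pi)" by (simp add: r_def)
    ultimately show "(r \<longlongrightarrow> r 0) (at_right 0)" using l0 Lim_transform_eventually by metis
    have "\<forall>\<^sub>F x in at_left pi. r0 x = r x" by (rule eventually_at_leftI[of 0 pi]) (auto simp: r_def)
    moreover have "r pi = 0" by (simp add: r_def)
    ultimately show "(r \<longlongrightarrow> r pi) (at_left pi)" using l1 Lim_transform_eventually by metis
    fix p assume p: "0 < p" "p < pi"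
    have "isCont r0 p"
      unfolding r0_def using p sin_gt_zero[OF p] by (intro continuous_intros) auto
    then have "(r0 \<longlongrightarrow> r p) (at p)" using p by (simp add: isCont_def r_def)
    moreover have "\<forall>\<^sub>F x in at p. r0 x = r x"
      using p by (intro eventually_at_in_open'[THEN eventually_mono, of "{0<..<pi}"]) (auto simp: r_def)
    ultimately show "(r \<longlongrightarrow> r p) (at p)" by (rule Lim_transform_eventually)
  qed simp
  moreover have "beurling_kernel y p = 2 * ((1 + 2 * y) * sinc ((1 + 2 * y) * p)) + r p * sin ((1 + 2 * y) * p)"
    if p: "p \<in> {0<..<pi}" for p y
  proof -
    define l where "l = 1 + 2 * y"
    have "l * sinc (l * p) = sin (l * p) / p" by (cases "l = 0") (use p in auto)
    moreover have "r p = 2 * (1 - p / pi) / sin p - 2 / p" using p by (simp add: r_def r0_def)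
    ultimately show ?thesis
      unfolding beurling_kernel_def l_def[symmetric] by (simp only: left_diff_distrib) (simp add: mult_ac)
  qed
  ultimately show ?thesis by blast
qed

lemma beurling_kernel_has_integral:
  obtains r where "continuous_on {0..pi} r" "\<And>y. (beurling_kernel y has_integral
     2 * Si ((1 + 2 * y) * pi) + integral {0..pi} (\<lambda>p. r p * sin ((1 + 2 * y) * p))) {0..pi}"
proof -
  obtain r :: "real \<Rightarrow> real" where r: "continuous_on {0..pi} r"
    and eq: "\<And>p y. p \<in> {0<..<pi} \<Longrightarrow> beurling_kernel y p = 2 * ((1 + 2 * y) * sinc ((1 + 2 * y) * p)) + r p * sin ((1 + 2 * y) * p)"
    using beurling_kernel_sinc_decomposition by blast
  have "(beurling_kernel y has_integral
     2 * Si ((1 + 2 * y) * pi) + integral {0..pi} (\<lambda>p. r p * sin ((1 + 2 * y) * p))) {0..pi}" for y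
  proof -
    define l where "l = 1 + 2 * y"
    have i1: "((\<lambda>p. 2 * (l * sinc (l * p))) has_integral 2 * Si (l * pi) - 2 * Si (l * 0)) {0..pi}"
    proof (rule fundamental_theorem_of_calculus)
      fix p assume "p \<in> {0..pi}"
      have "((\<lambda>p. l * p) has_real_derivative l) (at p within {0..pi})"
        by (auto intro!: derivative_eq_intros)
      then have "((\<lambda>p. 2 * Si (l * p)) has_real_derivative 2 * (sinc (l * p) * l)) (at p within {0..pi})"
        by (intro DERIV_cmult DERIV_chain2[OF DERIV_Si])
      then show "((\<lambda>p. 2 * Si (l * p)) has_vector_derivative 2 * (l * sinc (l * p))) (at p within {0..pi})"
        by (simp only: has_real_derivative_iff_has_vector_derivative mult.commute)
    qed simp
    have i2: "((\<lambda>p. r p * sin (l * p)) has_integral integral {0..pi} (\<lambda>p. r p * sin (l * p))) {0..pi}"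
      by (intro integrable_integral integrable_continuous_interval continuous_intros r)
    have "Si 0 = 0" by (simp add: Si_def zero_ereal_def[symmetric])
    then have i3: "((\<lambda>p. 2 * (l * sinc (l * p)) + r p * sin (l * p)) has_integral
       2 * Si (l * pi) + integral {0..pi} (\<lambda>p. r p * sin (l * p))) {0..pi}"
      using has_integral_add[OF i1 i2] by (simp only: mult_zero_right diff_zero)
    have eq': "beurling_kernel y p = 2 * (l * sinc (l * p)) + r p * sin (l * p)" if "p \<in> {0..pi} - {0, pi}" for p
      unfolding l_def using that by (intro eq) auto
    show ?thesis
      unfolding l_def[symmetric] by (rule has_integral_spike_finite[of "{0, pi}", OF _ eq' i3]) simp_all
  qed
  then show ?thesis by (rule that[OF r])
qed

lemma beurling_kernel_integrable: "beurling_kernel y integrable_on {0..pi}"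
  using beurling_kernel_has_integral by (metis has_integral_integrable)

text \<open>The sine integral tends to pi / 2, and the continuous remainder contributes nothing in
  the limit.\<close>

lemma integral_beurling_kernel_at_top:
  "((\<lambda>y. integral {0..pi} (beurling_kernel y)) \<longlongrightarrow> pi) at_top"
proof -
  obtain r where r: "continuous_on {0..pi} r" and i: "\<And>y. (beurling_kernel y has_integral
     2 * Si ((1 + 2 * y) * pi) + integral {0..pi} (\<lambda>p. r p * sin ((1 + 2 * y) * p))) {0..pi}"
    by (rule beurling_kernel_has_integral) (rule that)
  have "((\<lambda>y. 2 * Si ((1 + 2 * y) * pi)) \<longlongrightarrow> 2 * (pi / 2)) at_top"
    by (intro tendsto_mult tendsto_const filterlim_compose[OF Si_at_top]) real_asymp
  moreover have "filterlim (\<lambda>y::real. 1 + 2 * y) at_top at_top" by real_asymp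
  then have "((\<lambda>y. integral {0..pi} (\<lambda>p. r p * sin ((1 + 2 * y) * p))) \<longlongrightarrow> 0) at_top"
    using filterlim_compose[OF Riemann_Lebesgue_sin[OF r pi_ge_zero]] by blast
  ultimately show ?thesis
    using tendsto_add[of "\<lambda>y. 2 * Si ((1 + 2 * y) * pi)" "2 * (pi / 2)" at_top _ 0] by (simp add: integral_unique[OF i])
qed

text \<open>The reflection flips the sign of 1 + 2 y. It carries the limit pi at infinity over to -
  pi at minus infinity.\<close>

lemma integral_beurling_kernel_reflect:
  "integral {0..pi} (beurling_kernel (- 1 - y)) = - integral {0..pi} (beurling_kernel y)"
proof -
  have "(1 + 2 * (- 1 - y)) * p = - ((1 + 2 * y) * p)" for p by (simp add: algebra_simps)
  then have "beurling_kernel (- 1 - y) = (\<lambda>p. - beurling_kernel y p)"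
    by (simp add: beurling_kernel_def fun_eq_iff)
  then show ?thesis by simp
qed

lemma integral_beurling_kernel_at_bot:
  "((\<lambda>y. integral {0..pi} (beurling_kernel y)) \<longlongrightarrow> - pi) at_bot"
proof -
  have "filterlim (\<lambda>y::real. - 1 - y) at_top at_bot" by real_asymp
  then have "((\<lambda>y. - integral {0..pi} (beurling_kernel (- 1 - y))) \<longlongrightarrow> - pi) at_bot"
    by (intro tendsto_minus filterlim_compose[OF integral_beurling_kernel_at_top])
  then show ?thesis by (simp add: integral_beurling_kernel_reflect)
qed

text \<open>The two sines differ by 2 cos (2 y p) sin p, which cancels the denominator. What remains
  is the cosine transform of a triangle, hence a Fejer kernel in y.\<close>

lemma integral_beurling_kernel_diff:
  assumes "y \<noteq> 0"
  shows "integral {0..pi} (beurling_kernel y) - integral {0..pi} (beurling_kernel (y - 1)) = 2 * (sin (pi * y))\<^sup>2 / (pi * y\<^sup>2)"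
proof -
  let ?F = "\<lambda>p. 2 * (1 - p / pi) * sin (2 * y * p) / y - cos (2 * y * p) / (pi * y\<^sup>2)"
  have i: "((\<lambda>p. 4 * (1 - p / pi) * cos (2 * y * p)) has_integral ?F pi - ?F 0) {0..pi}"
  proof (rule fundamental_theorem_of_calculus)
    fix p assume "p \<in> {0..pi}"
    have "(?F has_real_derivative 4 * (1 - p / pi) * cos (2 * y * p)) (at p within {0..pi})"
      using assms by (auto intro!: derivative_eq_intros simp: power2_eq_square field_simps)
    then show "(?F has_vector_derivative 4 * (1 - p / pi) * cos (2 * y * p)) (at p within {0..pi})"
      by (simp only: has_real_derivative_iff_has_vector_derivative)
  qed simp
  have eq: "beurling_kernel y p - beurling_kernel (y - 1) p = 4 * (1 - p / pi) * cos (2 * y * p)"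
    if "p \<in> {0..pi} - {0, pi}" for p
  proof -
    have "sin ((1 + 2 * y) * p) - sin ((1 + 2 * (y - 1)) * p) = 2 * cos (2 * y * p) * sin p"
      using sin_diff_sin[of "(1 + 2 * y) * p" "(1 + 2 * (y - 1)) * p"] by (simp add: algebra_simps)
    moreover have "sin p > 0" using that by (intro sin_gt_zero) auto
    ultimately show ?thesis by (simp add: beurling_kernel_def field_simps)
  qed
  have "((\<lambda>p. beurling_kernel y p - beurling_kernel (y - 1) p) has_integral ?F pi - ?F 0) {0..pi}"
    by (rule has_integral_spike_finite[of "{0, pi}", OF _ eq i]) simp_all
  then have "integral {0..pi} (beurling_kernel y) - integral {0..pi} (beurling_kernel (y - 1)) = ?F pi - ?F 0"
    by (simp add: has_integral_iff integral_diff beurling_kernel_integrable)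
  also have "\<dots> = (1 - cos (2 * (pi * y))) / (pi * y\<^sup>2)"
    by (simp add: diff_divide_distrib mult_ac)
  also have "\<dots> = 2 * (sin (pi * y))\<^sup>2 / (pi * y\<^sup>2)"
    by (simp add: cos_double_sin)
  finally show ?thesis .
qed

lemma sin_squared_pi_shift: "(sin (pi * (y + real n)))\<^sup>2 = (sin (pi * y))\<^sup>2" "(sin (pi * (y - real n)))\<^sup>2 = (sin (pi * y))\<^sup>2"
proof -
  have "(sin (pi * (y + real n)))\<^sup>2 = (sin (pi * y))\<^sup>2" for y
    using cos_double_sin[of "pi * (y + real n)"] cos_double_sin[of "pi * y"] cos.plus_of_nat[of "2 * (pi * y)" n]
    by (simp add: algebra_simps)
  from this[of y] this[of "y - real n"] show "(sin (pi * (y + real n)))\<^sup>2 = (sin (pi * y))\<^sup>2" "(sin (pi * (y - real n)))\<^sup>2 = (sin (pi * y))\<^sup>2"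
    by simp_all
qed

text \<open>
  Up to the factor \<open>\<pi>\<close> this is Beurling's extremal majorant of the sign function, in the form of
  its Fourier integral. The majorant property follows by telescoping the exact difference equation
  \<open>integral_beurling_kernel_diff\<close> towards the limits at infinity.
\<close>

definition beurling :: "real \<Rightarrow> real" where
  "beurling y = integral {0..pi} (\<lambda>p. beurling_kernel y p + 2 / pi * sin (2 * y * p))"

lemma beurling_eq:
  assumes "y \<noteq> 0"
  shows "beurling y = integral {0..pi} (beurling_kernel y) + 2 * (sin (pi * y))\<^sup>2 / (pi * y)"
proof -
  let ?F = "\<lambda>p. - cos (2 * y * p) / (pi * y)"
  have i: "((\<lambda>p. 2 / pi * sin (2 * y * p)) has_integral ?F pi - ?F 0) {0..pi}"
    by (rule fundamental_theorem_of_calculus)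
       (use assms in \<open>auto intro!: derivative_eq_intros simp: field_simps
               has_real_derivative_iff_has_vector_derivative[symmetric]\<close>)
  have "?F pi - ?F 0 = (1 - cos (2 * (pi * y))) / (pi * y)"
    by (simp add: diff_divide_distrib mult_ac)
  also have "\<dots> = 2 * (sin (pi * y))\<^sup>2 / (pi * y)"
    by (simp add: cos_double_sin)
  finally show ?thesis
    using i beurling_kernel_integrable[of y] by (simp add: beurling_def integral_add has_integral_iff)
qed

text \<open>Since sin^2 (pi y) has period 1, the difference equation writes \<open>?I y\<close> as
  \<open>?I (y + real N)\<close> minus the sum of c / (y + k)^2 over k = 1, ..., N. Telescoping
  keeps this sum below c / y, which is exactly the second term in
  \<open>beurling_eq\<close>.\<close>

lemma beurling_ge_pi:
  assumes "y > 0"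
  shows "beurling y \<ge> pi"
proof -
  let ?I = "\<lambda>y. integral {0..pi} (beurling_kernel y)"
  define c where "c = 2 * (sin (pi * y))\<^sup>2 / pi"
  have "c \<ge> 0" by (simp add: c_def)
  have *: "?I (y + real N) \<le> ?I y + c * (1 / y - 1 / (y + real N))" for N
  proof (induction N)
    case (Suc N)
    have pos: "y + real N > 0" using assms by simp
    have "?I (y + real (Suc N)) - ?I (y + real N) = 2 * (sin (pi * (y + real (Suc N))))\<^sup>2 / (pi * (y + real (Suc N))\<^sup>2)"
      using integral_beurling_kernel_diff[of "y + real (Suc N)"] assms by (simp add: algebra_simps)
    also have "\<dots> = c * (1 / (y + real (Suc N))\<^sup>2)"
      unfolding sin_squared_pi_shift by (simp add: c_def)
    also have "\<dots> \<le> c * (1 / (y + real N) - 1 / (y + real (Suc N)))"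
      using inverse_square_telescope(1)[OF pos] \<open>c \<ge> 0\<close> by (intro mult_left_mono) (auto simp: algebra_simps)
    finally show ?case using Suc by (simp add: algebra_simps)
  qed simp
  have "?I (y + real N) \<le> beurling y" for N
  proof -
    have "c * (1 / y - 1 / (y + real N)) \<le> c * (1 / y)"
      using assms \<open>c \<ge> 0\<close> by (intro mult_left_mono) auto
    then show ?thesis using *[of N] beurling_eq[of y] assms by (simp add: c_def)
  qed
  moreover have "filterlim (\<lambda>N. y + real N) at_top sequentially" by real_asymp
  then have "(\<lambda>N. ?I (y + real N)) \<longlonglongrightarrow> pi"
    by (rule filterlim_compose[OF integral_beurling_kernel_at_top])
  ultimately show ?thesis by (intro LIMSEQ_le_const2) auto
qed

text \<open>For negative y the telescoping bound is used from below: the sum compensates the second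
  term of \<open>beurling_eq\<close>, which is now negative. At y = 0 that formula divides by zero,
  but there the integrand is nonnegative.\<close>

lemma beurling_ge_minus_pi:
  "beurling y \<ge> - pi"
proof -
  let ?I = "\<lambda>y. integral {0..pi} (beurling_kernel y)"
  consider "y > 0" | "y = 0" | "y < 0" by linarith
  then show ?thesis
  proof cases
    case 1
    then show ?thesis using beurling_ge_pi[of y] pi_gt_zero by linarith
  next
    case 2
    have "0 \<le> integral {0..pi} (beurling_kernel 0)"
    proof (rule integral_nonneg[OF beurling_kernel_integrable])
      fix p :: real assume "p \<in> {0..pi}"
      then have "0 \<le> 1 - p / pi" by simp
      moreover have "0 \<le> sin p / sin p" by (cases "sin p = 0") auto
      moreover have "beurling_kernel 0 p = 2 * (1 - p / pi) * (sin p / sin p)" by (simp only: beurling_kernel_def) simp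
      ultimately show "0 \<le> beurling_kernel 0 p" by (metis mult_nonneg_nonneg zero_le_numeral)
    qed
    then have "0 \<le> beurling 0" by (simp add: beurling_def)
    then show ?thesis unfolding 2 using pi_gt_zero by linarith
  next
    case 3
    define x where "x = - y"
    have x: "x > 0" using 3 by (simp add: x_def)
    define c where "c = 2 * (sin (pi * y))\<^sup>2 / pi"
    have "c \<ge> 0" by (simp add: c_def)
    have *: "?I (y - real N) + c * (1 / x - 1 / (x + real N)) \<le> ?I y" for N
    proof (induction N)
      case (Suc N)
      have pos: "x + real N > 0" using x by simp
      have "?I (y - real N) - ?I (y - real (Suc N)) = 2 * (sin (pi * (y - real N)))\<^sup>2 / (pi * (y - real N)\<^sup>2)"
        using integral_beurling_kernel_diff[of "y - real N"] 3 by (simp add: algebra_simps)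
      also have "\<dots> = c * (1 / (x + real N)\<^sup>2)"
      proof -
        have "(y - real N)\<^sup>2 = (x + real N)\<^sup>2" by (simp add: x_def power2_eq_square algebra_simps)
        then show ?thesis unfolding sin_squared_pi_shift by (simp add: c_def)
      qed
      also have "\<dots> \<ge> c * (1 / (x + real N) - 1 / (x + real (Suc N)))"
        using inverse_square_telescope(2)[OF pos] \<open>c \<ge> 0\<close> by (intro mult_left_mono) (auto simp: algebra_simps)
      finally show ?case using Suc by (simp add: algebra_simps)
    qed simp
    have "?I (y - real N) - c * (1 / (x + real N)) \<le> beurling y" for N
    proof -
      have "beurling y = ?I y - c * (1 / x)" using beurling_eq[of y] 3 by (simp add: c_def x_def)
      then show ?thesis using *[of N] unfolding right_diff_distrib by linarith
    qed
    moreover have "filterlim (\<lambda>N. y - real N) at_bot sequentially" by real_asymp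
    then have "(\<lambda>N. ?I (y - real N)) \<longlonglongrightarrow> - pi"
      by (rule filterlim_compose[OF integral_beurling_kernel_at_bot])
    then have "(\<lambda>N. ?I (y - real N) - c * (1 / (x + real N))) \<longlonglongrightarrow> - pi - c * 0"
      by (intro tendsto_diff tendsto_mult tendsto_const) (auto, real_asymp)
    ultimately show ?thesis by (intro LIMSEQ_le_const2) auto
  qed
qed

section \<open>Characteristic functions under a third moment bound\<close>

lemma exp_minus_le_quadratic:
  fixes y :: real
  assumes "0 \<le> y"
  shows "exp (- y) \<le> 1 - y + y\<^sup>2 / 2"
proof -
  let ?f = "\<lambda>y::real. 1 - y + y\<^sup>2 / 2 - exp (- y)"
  have "?f 0 \<le> ?f y"
  proof (rule DERIV_nonneg_imp_nondecreasing[of 0 y ?f])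
    fix z :: real
    have "DERIV ?f z :> z - 1 + exp (- z)" by (auto intro!: derivative_eq_intros)
    moreover have "0 \<le> z - 1 + exp (- z)" using exp_ge_add_one_self[of "- z"] by linarith
    ultimately show "\<exists>d. DERIV ?f z :> d \<and> 0 \<le> d" by blast
  qed (use assms in auto)
  then show ?thesis by simp
qed

lemma abs_cube_eq: "\<bar>x\<bar> ^ 3 = \<bar>x\<bar> * x\<^sup>2" for x :: real
  by (simp add: power3_eq_cube power2_eq_square mult_ac)

text \<open>Both sides begin with 1 - 4/5 v. The fourth power on the right, instead of a square,
  makes room for (v / 6)^2 at second order and still lies below exp (- 4/5 v).\<close>

lemma quadratic_sum_le_quartic:
  fixes v :: real
  assumes "0 \<le> v" "v \<le> 1"
  shows "(1 - 2 / 5 * v)\<^sup>2 + (v / 6)\<^sup>2 \<le> (1 - v / 5) ^ 4"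
proof -
  have "v * v * v \<le> v * v * 1" using assms by (intro mult_left_mono) auto
  moreover have "0 \<le> v * v" "0 \<le> v * v * v * v" using assms by simp_all
  moreover have "(1 - v / 5) ^ 4 - ((1 - 2 / 5 * v)\<^sup>2 + (v / 6)\<^sup>2) =
      47 / 900 * (v * v) - 4 / 125 * (v * v * v) + (v * v * v * v) / 625"
    unfolding power2_eq_square power4_eq_xxxx by (simp add: field_simps)
  ultimately show ?thesis by linarith
qed

locale centered_third_moment = real_distribution M for M +
  fixes K :: real
  assumes K_pos: "K > 0"
    and integrable_cube: "integrable M (\<lambda>x. \<bar>x\<bar> ^ 3)"
    and mean_zero: "expectation (\<lambda>x. x) = 0"
    and cube_le: "expectation (\<lambda>x. \<bar>x\<bar> ^ 3) \<le> K * expectation (\<lambda>x. x\<^sup>2)"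
begin

abbreviation \<sigma>2 :: real where "\<sigma>2 \<equiv> expectation (\<lambda>x. x\<^sup>2)"

lemma integrable_below_cube:
  assumes [measurable]: "f \<in> borel_measurable borel" and "\<And>x. \<bar>f x\<bar> \<le> 1 + \<bar>x\<bar> ^ 3"
  shows "integrable M f"
proof (rule Bochner_Integration.integrable_bound)
  show "integrable M (\<lambda>x. 1 + \<bar>x\<bar> ^ 3)" using integrable_cube by simp
qed (use assms(2) in \<open>auto simp: abs_le_iff intro: order_trans\<close>)

lemma moment_le_cube: "\<bar>x\<bar> \<le> 1 + \<bar>x\<bar> ^ 3" "x\<^sup>2 \<le> 1 + \<bar>x\<bar> ^ 3" for x :: real
proof -
  have cube: "0 \<le> \<bar>x\<bar> ^ 3" by simp
  show "\<bar>x\<bar> \<le> 1 + \<bar>x\<bar> ^ 3"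
  proof (cases "\<bar>x\<bar> \<le> 1")
    case True
    then show ?thesis using cube by linarith
  next
    case False
    then show ?thesis using power_increasing[of 1 3 "\<bar>x\<bar>"] by simp
  qed
  show "x\<^sup>2 \<le> 1 + \<bar>x\<bar> ^ 3"
  proof (cases "\<bar>x\<bar> \<le> 1")
    case True
    then have "\<bar>x\<bar>\<^sup>2 \<le> 1" by (intro power_le_one) auto
    then show ?thesis using cube unfolding power2_abs by linarith
  next
    case False
    then have "\<bar>x\<bar>\<^sup>2 \<le> \<bar>x\<bar> ^ 3" by (intro power_increasing) auto
    then show ?thesis unfolding power2_abs by linarith
  qed
qed

lemma integrable_moments [simp, intro]:
  "integrable M (\<lambda>x. x)" "integrable M (\<lambda>x. \<bar>x\<bar>)" "integrable M (\<lambda>x. x\<^sup>2)"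
  "integrable M (\<lambda>x. x * \<bar>x\<bar>)" "integrable M (\<lambda>x. \<bar>x\<bar> * x\<^sup>2)"
proof -
  show "integrable M (\<lambda>x. x)" "integrable M (\<lambda>x. \<bar>x\<bar>)" "integrable M (\<lambda>x. x\<^sup>2)" "integrable M (\<lambda>x. x * \<bar>x\<bar>)"
    using moment_le_cube by (auto intro!: integrable_below_cube simp: abs_mult power2_eq_square)
  show "integrable M (\<lambda>x. \<bar>x\<bar> * x\<^sup>2)"
    using integrable_cube by (simp add: abs_cube_eq)
qed

lemma variance_nonneg: "0 \<le> \<sigma>2"
  by (intro Bochner_Integration.integral_nonneg) simp

text \<open>A consequence of Lyapunov's inequality. Integrating the nonnegative polynomial (|x| -
  K)^2 (|x| + K/2) gives it without fractional powers and without dividing by the variance.\<close>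

lemma variance_le: "\<sigma>2 \<le> K\<^sup>2"
proof -
  have "0 \<le> expectation (\<lambda>x. \<bar>x\<bar> ^ 3 - 3 / 2 * K * x\<^sup>2 + K ^ 3 / 2)"
  proof (rule Bochner_Integration.integral_nonneg)
    fix x :: real
    have "\<bar>x\<bar> ^ 3 - 3 / 2 * K * \<bar>x\<bar>\<^sup>2 + K ^ 3 / 2 = (\<bar>x\<bar> - K)\<^sup>2 * (\<bar>x\<bar> + K / 2)"
      unfolding power2_eq_square power3_eq_cube by (simp add: field_simps)
    then show "0 \<le> \<bar>x\<bar> ^ 3 - 3 / 2 * K * x\<^sup>2 + K ^ 3 / 2" using K_pos by simp
  qed
  also have "\<dots> = expectation (\<lambda>x. \<bar>x\<bar> ^ 3) - 3 / 2 * K * \<sigma>2 + K ^ 3 / 2"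
    using integrable_cube prob_space by simp
  finally have "K * \<sigma>2 \<le> K * K\<^sup>2" using cube_le by (simp add: power3_eq_cube power2_eq_square)
  then show ?thesis using K_pos by simp
qed

lemma abs_moment_le: "expectation (\<lambda>x. \<bar>x\<bar>) \<le> K"
proof -
  have "expectation (\<lambda>x. \<bar>x\<bar>) \<le> expectation (\<lambda>x. x\<^sup>2 / (2 * K) + K / 2)"
  proof (rule integral_mono)
    fix x :: real
    have "0 \<le> (\<bar>x\<bar> - K)\<^sup>2" by simp
    then show "\<bar>x\<bar> \<le> x\<^sup>2 / (2 * K) + K / 2"
      using K_pos by (simp add: power2_eq_square field_simps)
  qed (auto intro!: Bochner_Integration.integrable_add)
  also have "\<dots> = \<sigma>2 / (2 * K) + K / 2" using prob_space by simp
  also have "\<dots> \<le> K" using variance_le K_pos by (simp add: field_simps power2_eq_square)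
  finally show ?thesis .
qed

lemma integrable_trig [simp, intro]:
  "integrable M (\<lambda>x. cos (u * x))" "integrable M (\<lambda>x. sin (u * x))"
  by (auto intro!: integrable_const_bound[of _ 1])

lemma Re_char: "Re (char M u) = expectation (\<lambda>x. cos (u * x))"
  and Im_char: "Im (char M u) = expectation (\<lambda>x. sin (u * x))"
proof -
  have "integrable M (\<lambda>x. iexp (u * x))"
    by (rule integrable_iexp) auto
  then show "Re (char M u) = expectation (\<lambda>x. cos (u * x))" "Im (char M u) = expectation (\<lambda>x. sin (u * x))"
    unfolding char_def by (simp_all flip: integral_Re integral_Im add: Re_exp Im_exp)
qed

lemma Re_char_ge: "1 - u\<^sup>2 * \<sigma>2 / 2 \<le> Re (char M u)"
proof -
  have "expectation (\<lambda>x. 1 - u\<^sup>2 * x\<^sup>2 / 2) \<le> expectation (\<lambda>x. cos (u * x))"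
    using cos_ge_quadratic[of "u * _"]
    by (intro integral_mono) (auto simp: power_mult_distrib)
  then show ?thesis using prob_space by (simp add: Re_char)
qed

lemma Re_char_le:
  assumes "u \<ge> 0"
  shows "Re (char M u) \<le> 1 - u\<^sup>2 * \<sigma>2 / 2 + u ^ 3 * (K * \<sigma>2) / 10"
proof -
  have "expectation (\<lambda>x. cos (u * x)) \<le> expectation (\<lambda>x. 1 - u\<^sup>2 * x\<^sup>2 / 2 + u ^ 3 * \<bar>x\<bar> ^ 3 / 10)"
    using cos_le_cubic[of "u * _"] integrable_cube assms
    by (intro integral_mono) (auto simp: power_mult_distrib abs_mult)
  also have "\<dots> = 1 - u\<^sup>2 * \<sigma>2 / 2 + u ^ 3 * expectation (\<lambda>x. \<bar>x\<bar> ^ 3) / 10"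
    using prob_space integrable_cube by simp
  also have "\<dots> \<le> 1 - u\<^sup>2 * \<sigma>2 / 2 + u ^ 3 * (K * \<sigma>2) / 10"
    using cube_le assms by (intro add_mono divide_right_mono mult_left_mono) auto
  finally show ?thesis by (simp add: Re_char)
qed

text \<open>Centering allows u x to be subtracted from the sine, so only the cubic error is
  left.\<close>

lemma Im_char_le:
  assumes "u \<ge> 0"
  shows "\<bar>Im (char M u)\<bar> \<le> u ^ 3 * (K * \<sigma>2) / 6"
proof -
  have "\<bar>expectation (\<lambda>x. sin (u * x) - u * x)\<bar> \<le> expectation (\<lambda>x. u ^ 3 * \<bar>x\<bar> ^ 3 / 6)"
    using abs_sin_diff_le[of "u * _"] integrable_cube assms
    by (intro integral_abs_bound[THEN order_trans] integral_mono)
       (auto simp: power_mult_distrib abs_mult)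
  also have "\<dots> = u ^ 3 * expectation (\<lambda>x. \<bar>x\<bar> ^ 3) / 6" by simp
  also have "\<dots> \<le> u ^ 3 * (K * \<sigma>2) / 6"
    using cube_le assms by (intro divide_right_mono mult_left_mono) auto
  finally show ?thesis by (simp add: Im_char mean_zero)
qed

text \<open>
  The real error is at most \<open>1/8\<close> and the imaginary error at most \<open>1/6\<close> of \<open>K \<sigma>2 u^3\<close>;
  the constant \<open>5/24\<close> comes from the triple \<open>(3, 4, 5)\<close>.
\<close>

lemma char_gaussian_diff_le:
  assumes "0 \<le> u" "K * u \<le> 1"
  shows "cmod (char M u - exp (- (\<sigma>2 * u\<^sup>2 / 2))) \<le> 5 / 24 * (K * \<sigma>2 * u ^ 3)"
proof -
  define g where "g = exp (- (\<sigma>2 * u\<^sup>2 / 2))"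
  define L where "L = K * \<sigma>2 * u ^ 3"
  have "L \<ge> 0" using K_pos assms variance_nonneg by (simp add: L_def)
  have g: "1 - \<sigma>2 * u\<^sup>2 / 2 \<le> g" "g \<le> 1 - \<sigma>2 * u\<^sup>2 / 2 + (\<sigma>2 * u\<^sup>2 / 2)\<^sup>2 / 2"
    using exp_ge_add_one_self[of "- (\<sigma>2 * u\<^sup>2 / 2)"] exp_minus_le_quadratic[of "\<sigma>2 * u\<^sup>2 / 2"] variance_nonneg
    by (simp_all add: g_def)
  have "\<sigma>2 * u \<le> K"
  proof -
    have "\<sigma>2 * u \<le> K * K * u" using variance_le assms by (intro mult_right_mono) (auto simp: power2_eq_square)
    also have "\<dots> = K * (K * u)" by simp
    also have "\<dots> \<le> K * 1" using assms K_pos by (intro mult_left_mono) auto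
    finally show ?thesis by simp
  qed
  then have "(\<sigma>2 * u) * (\<sigma>2 * u ^ 3) \<le> K * (\<sigma>2 * u ^ 3)"
    using assms variance_nonneg by (intro mult_right_mono) auto
  then have "(\<sigma>2 * u\<^sup>2 / 2)\<^sup>2 / 2 \<le> L / 8"
    by (simp add: L_def power2_eq_square power3_eq_cube mult_ac)
  \<comment> \<open>Both numbers lie between 1 - D and 1 - D + L / 8, so the two errors do not add
    up.\<close>
  then have re: "\<bar>Re (char M u) - g\<bar> \<le> L / 8"
  proof -
    define D where "D = \<sigma>2 * u\<^sup>2 / 2"
    have "1 - D \<le> Re (char M u)" "Re (char M u) \<le> 1 - D + L / 10"
      using Re_char_ge[of u] Re_char_le[OF assms(1)] by (simp_all add: D_def L_def mult_ac)
    then show ?thesis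
      using g \<open>(\<sigma>2 * u\<^sup>2 / 2)\<^sup>2 / 2 \<le> L / 8\<close> \<open>L \<ge> 0\<close> unfolding D_def[symmetric] by linarith
  qed
  have im: "\<bar>Im (char M u)\<bar> \<le> L / 6"
    using Im_char_le[OF assms(1)] by (simp add: L_def mult_ac)
  have "cmod (char M u - g) = sqrt ((Re (char M u) - g)\<^sup>2 + (Im (char M u))\<^sup>2)"
    by (simp add: cmod_def)
  also have "\<dots> \<le> sqrt ((L / 8)\<^sup>2 + (L / 6)\<^sup>2)"
    using power_mono[OF re, of 2] power_mono[OF im, of 2] by (intro real_sqrt_le_mono add_mono) auto
  also have "(L / 8)\<^sup>2 + (L / 6)\<^sup>2 = (5 / 24 * L)\<^sup>2" by (simp add: power2_eq_square)
  also have "sqrt \<dots> = 5 / 24 * L" using \<open>L \<ge> 0\<close> by (intro real_sqrt_unique) auto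
  finally show ?thesis by (simp add: g_def L_def)
qed

text \<open>For \<open>K * u \<le> 1\<close> the cubic error in the real part is at most v / 10 with
  v = \<open>\<sigma>2 * u\<^sup>2\<close>, which lowers the Gaussian rate from 1/2 to 2/5.\<close>

lemma norm_char_le_gaussian:
  assumes "0 \<le> u" "K * u \<le> 1"
  shows "cmod (char M u) \<le> exp (- (2 / 5 * \<sigma>2 * u\<^sup>2))"
proof -
  define v where "v = \<sigma>2 * u\<^sup>2"
  have "v \<ge> 0" using variance_nonneg by (simp add: v_def)
  have "v \<le> K\<^sup>2 * u\<^sup>2" using variance_le by (simp add: v_def mult_right_mono)
  also have "\<dots> = (K * u)\<^sup>2" by (simp add: power_mult_distrib)
  also have "\<dots> \<le> 1" using assms K_pos by (intro power_le_one) auto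
  finally have "v \<le> 1" .
  have "K * u * v \<le> 1 * v" using assms \<open>v \<ge> 0\<close> by (intro mult_right_mono) auto
  then have L: "u ^ 3 * (K * \<sigma>2) \<le> v" by (simp add: v_def power2_eq_square power3_eq_cube mult_ac)
  have re: "\<bar>Re (char M u)\<bar> \<le> 1 - 2 / 5 * v"
    using Re_char_ge[of u] Re_char_le[OF assms(1)] L \<open>v \<le> 1\<close> by (simp add: v_def mult_ac)
  have im: "\<bar>Im (char M u)\<bar> \<le> v / 6"
    using Im_char_le[OF assms(1)] L by linarith
  have "(cmod (char M u))\<^sup>2 = \<bar>Re (char M u)\<bar>\<^sup>2 + \<bar>Im (char M u)\<bar>\<^sup>2" by (simp add: cmod_power2)
  also have "\<dots> \<le> (1 - 2 / 5 * v)\<^sup>2 + (v / 6)\<^sup>2"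
    using re im by (intro add_mono power_mono) auto
  also have "\<dots> \<le> (1 - v / 5) ^ 4"
    using \<open>0 \<le> v\<close> \<open>v \<le> 1\<close> by (rule quadratic_sum_le_quartic)
  also have "\<dots> \<le> exp (- (4 / 5 * v))"
    using exp_ge_one_minus_x_over_n_power_n[of "4 / 5 * v" 4] \<open>v \<le> 1\<close> by simp
  also have "\<dots> = (exp (- (2 / 5 * v)))\<^sup>2" by (simp flip: exp_double)
  finally show ?thesis unfolding v_def by (auto dest: power2_le_imp_le simp: mult.assoc)
qed

text \<open>
  The squared modulus is the characteristic function of the symmetrised variable \<open>X - X'\<close>, and
  \<open>|x - y|^3 \<le> (|x| + |y|) (x - y)^2\<close> bounds its third absolute moment by \<open>4 K \<sigma>2\<close>. The double
  integral is evaluated as an iterated one, so no product measure is needed.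
\<close>

lemma norm_char_square_le:
  assumes "0 \<le> u"
  shows "(cmod (char M u))\<^sup>2 \<le> 1 - \<sigma>2 * (u\<^sup>2 - 2 / 5 * K * u ^ 3)"
proof -
  define C where "C = expectation (\<lambda>x. cos (u * x))"
  define S where "S = expectation (\<lambda>x. sin (u * x))"
  define \<beta> where "\<beta> = expectation (\<lambda>x. \<bar>x\<bar>)"
  define \<tau> where "\<tau> = expectation (\<lambda>x. x * \<bar>x\<bar>)"
  define \<rho> where "\<rho> = expectation (\<lambda>x. \<bar>x\<bar> * x\<^sup>2)"
  have inner: "cos (u * x) * C + sin (u * x) * S \<le>
      1 - u\<^sup>2 / 2 * (x\<^sup>2 + \<sigma>2) + u ^ 3 / 10 * (\<bar>x\<bar> * x\<^sup>2 + \<bar>x\<bar> * \<sigma>2 + \<beta> * x\<^sup>2 - 2 * x * \<tau> + \<rho>)" for x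
  proof -
    have "cos (u * x) * C + sin (u * x) * S = expectation (\<lambda>y. cos (u * x) * cos (u * y) + sin (u * x) * sin (u * y))"
      by (simp add: C_def S_def)
    also have "\<dots> \<le> expectation (\<lambda>y. 1 - u\<^sup>2 / 2 * (x\<^sup>2 - 2 * x * y + y\<^sup>2) +
      u ^ 3 / 10 * (\<bar>x\<bar> * x\<^sup>2 - 2 * x * \<bar>x\<bar> * y + \<bar>x\<bar> * y\<^sup>2 + x\<^sup>2 * \<bar>y\<bar> - 2 * x * (y * \<bar>y\<bar>) + \<bar>y\<bar> * y\<^sup>2))"
    proof (rule integral_mono)
      fix y
      have "\<bar>u * (x - y)\<bar> ^ 3 = u ^ 3 * (\<bar>x - y\<bar> * (x - y)\<^sup>2)"
        using assms by (simp add: abs_mult power_mult_distrib power3_eq_cube power2_eq_square mult.assoc)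
      also have "\<dots> \<le> u ^ 3 * ((\<bar>x\<bar> + \<bar>y\<bar>) * (x - y)\<^sup>2)"
        using assms by (intro mult_left_mono mult_right_mono) auto
      also have "(\<bar>x\<bar> + \<bar>y\<bar>) * (x - y)\<^sup>2 = \<bar>x\<bar> * x\<^sup>2 - 2 * x * \<bar>x\<bar> * y + \<bar>x\<bar> * y\<^sup>2 + x\<^sup>2 * \<bar>y\<bar> - 2 * x * (y * \<bar>y\<bar>) + \<bar>y\<bar> * y\<^sup>2"
        by (simp add: power2_eq_square algebra_simps)
      finally have "\<bar>u * (x - y)\<bar> ^ 3 / 10 \<le> u ^ 3 / 10 * (\<bar>x\<bar> * x\<^sup>2 - 2 * x * \<bar>x\<bar> * y + \<bar>x\<bar> * y\<^sup>2 + x\<^sup>2 * \<bar>y\<bar> - 2 * x * (y * \<bar>y\<bar>) + \<bar>y\<bar> * y\<^sup>2)"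
        by simp
      moreover have "(u * (x - y))\<^sup>2 / 2 = u\<^sup>2 / 2 * (x\<^sup>2 - 2 * x * y + y\<^sup>2)"
        by (simp add: power2_eq_square field_simps)
      moreover have "cos (u * x) * cos (u * y) + sin (u * x) * sin (u * y) = cos (u * (x - y))"
        by (simp add: cos_diff right_diff_distrib)
      ultimately show "cos (u * x) * cos (u * y) + sin (u * x) * sin (u * y) \<le>
        1 - u\<^sup>2 / 2 * (x\<^sup>2 - 2 * x * y + y\<^sup>2) + u ^ 3 / 10 * (\<bar>x\<bar> * x\<^sup>2 - 2 * x * \<bar>x\<bar> * y + \<bar>x\<bar> * y\<^sup>2 + x\<^sup>2 * \<bar>y\<bar> - 2 * x * (y * \<bar>y\<bar>) + \<bar>y\<bar> * y\<^sup>2)"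
        using cos_le_cubic[of "u * (x - y)"] by linarith
    qed (simp_all add: integrable_trig)
    also have "\<dots> = 1 - u\<^sup>2 / 2 * (x\<^sup>2 + \<sigma>2) + u ^ 3 / 10 * (\<bar>x\<bar> * x\<^sup>2 + \<bar>x\<bar> * \<sigma>2 + x\<^sup>2 * \<beta> - 2 * x * \<tau> + \<rho>)"
      using prob_space by (simp add: mean_zero \<beta>_def \<tau>_def \<rho>_def)
    finally show ?thesis by (simp add: mult.commute)
  qed
  have "(cmod (char M u))\<^sup>2 = C * C + S * S"
    unfolding cmod_power2 Re_char Im_char C_def S_def by (simp add: power2_eq_square)
  also have "\<dots> = expectation (\<lambda>x. cos (u * x) * C + sin (u * x) * S)"
    by (simp add: C_def S_def)
  also have "\<dots> \<le> expectation (\<lambda>x. 1 - u\<^sup>2 / 2 * (x\<^sup>2 + \<sigma>2) +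
      u ^ 3 / 10 * (\<bar>x\<bar> * x\<^sup>2 + \<bar>x\<bar> * \<sigma>2 + \<beta> * x\<^sup>2 - 2 * x * \<tau> + \<rho>))"
    by (intro integral_mono inner) simp_all
  also have "\<dots> = 1 - u\<^sup>2 / 2 * (\<sigma>2 + \<sigma>2) + u ^ 3 / 10 * (\<rho> + \<beta> * \<sigma>2 + \<beta> * \<sigma>2 - 2 * 0 * \<tau> + \<rho>)"
    using prob_space by (simp add: mean_zero flip: \<beta>_def \<rho>_def)
  also have "\<dots> = 1 - u\<^sup>2 * \<sigma>2 + u ^ 3 / 5 * (\<rho> + \<beta> * \<sigma>2)" by (simp add: algebra_simps)
  also have "\<dots> \<le> 1 - u\<^sup>2 * \<sigma>2 + u ^ 3 / 5 * (K * \<sigma>2 + K * \<sigma>2)"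
  proof -
    have "\<rho> \<le> K * \<sigma>2" using cube_le by (simp add: \<rho>_def abs_cube_eq)
    moreover have "\<beta> * \<sigma>2 \<le> K * \<sigma>2" using abs_moment_le variance_nonneg by (simp add: \<beta>_def mult_right_mono)
    ultimately show ?thesis using assms by (intro add_left_mono mult_left_mono add_mono) auto
  qed
  finally show ?thesis by (simp add: algebra_simps)
qed

lemma norm_char_le:
  assumes "0 \<le> u"
  shows "cmod (char M u) \<le> exp (- (\<sigma>2 * (u\<^sup>2 / 2 - K * u ^ 3 / 5)))"
proof -
  have "(cmod (char M u))\<^sup>2 \<le> 1 + - (\<sigma>2 * (u\<^sup>2 - 2 / 5 * K * u ^ 3))"
    using norm_char_square_le[OF assms] by simp
  also have "\<dots> \<le> exp (- (\<sigma>2 * (u\<^sup>2 - 2 / 5 * K * u ^ 3)))" by (rule exp_ge_add_one_self)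
  also have "\<dots> = (exp (- (\<sigma>2 * (u\<^sup>2 / 2 - K * u ^ 3 / 5))))\<^sup>2"
    by (simp flip: exp_double add: algebra_simps)
  finally show ?thesis by (auto dest: power2_le_imp_le)
qed

text \<open>Factoring z^n - w^n leaves sums of products of n - 1 factors, each of modulus at most r.
  Restoring the missing factor costs exp (2/5 \<open>\<sigma>2 * u\<^sup>2\<close>), which is at
  most 3/2 because \<open>\<sigma>2 * u\<^sup>2\<close> is at most 1.\<close>

lemma char_power_gaussian_diff_le:
  assumes "0 \<le> u" "K * u \<le> 1" "A = real n * \<sigma>2"
  shows "cmod (char M u ^ n - exp (- (A * u\<^sup>2 / 2))) \<le> 5 / 24 * (K * A * u ^ 3) * (3 / 2 * exp (- (2 / 5 * A * u\<^sup>2)))"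
proof (cases n)
  case (Suc m)
  define z where "z = char M u"
  define w where "w = complex_of_real (exp (- (\<sigma>2 * u\<^sup>2 / 2)))"
  define r where "r = exp (- (2 / 5 * \<sigma>2 * u\<^sup>2))"
  have z: "cmod z \<le> r" unfolding z_def r_def by (rule norm_char_le_gaussian) fact+
  have w: "cmod w \<le> r"
    using variance_nonneg by (simp add: w_def r_def mult_right_mono)
  have "z ^ n - w ^ n = (z - w) * (\<Sum>i<n. w ^ (n - Suc i) * z ^ i)"
    by (rule power_diff_sumr2)
  also have "cmod \<dots> \<le> 5 / 24 * (K * \<sigma>2 * u ^ 3) * (\<Sum>i<n. r ^ m)"
    unfolding norm_mult
  proof (intro mult_mono)
    show "cmod (z - w) \<le> 5 / 24 * (K * \<sigma>2 * u ^ 3)"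
      unfolding z_def w_def by (rule char_gaussian_diff_le) fact+
    show "cmod (\<Sum>i<n. w ^ (n - Suc i) * z ^ i) \<le> (\<Sum>i<n. r ^ m)"
    proof (rule sum_norm_le)
      fix i assume "i \<in> {..<n}"
      then have "r ^ m = r ^ (n - Suc i) * r ^ i" by (simp add: Suc flip: power_add)
      then show "cmod (w ^ (n - Suc i) * z ^ i) \<le> r ^ m"
        unfolding norm_mult norm_power using z w by (auto intro!: mult_mono power_mono simp: r_def)
    qed
  qed (use K_pos assms variance_nonneg in auto)
  also have "\<dots> = 5 / 24 * (K * A * u ^ 3) * r ^ m" using assms(3) by simp
  finally have "cmod (z ^ n - w ^ n) \<le> 5 / 24 * (K * A * u ^ 3) * r ^ m" .
  also have "\<dots> \<le> 5 / 24 * (K * A * u ^ 3) * (3 / 2 * exp (- (2 / 5 * A * u\<^sup>2)))"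
  proof (rule mult_left_mono)
    show "r ^ m \<le> 3 / 2 * exp (- (2 / 5 * A * u\<^sup>2))"
  proof -
    have "\<sigma>2 * u\<^sup>2 \<le> (K * u)\<^sup>2" using variance_le by (simp add: power_mult_distrib mult_right_mono)
    also have "\<dots> \<le> 1" using assms K_pos by (intro power_le_one) auto
    finally have "exp (2 / 5 * (\<sigma>2 * u\<^sup>2)) \<le> exp (2 / 5)" by (simp add: mult.commute)
    also have "\<dots> \<le> 3 / (2::real)"
      using exp_ge_one_minus_x_over_n_power_n[of "2/5" 16] by (simp add: exp_minus field_simps)
    finally have "exp (2 / 5 * (\<sigma>2 * u\<^sup>2)) \<le> 3 / 2" .
    moreover have "r ^ m = exp (2 / 5 * (\<sigma>2 * u\<^sup>2)) * exp (- (2 / 5 * A * u\<^sup>2))"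
      unfolding r_def exp_of_nat_mult[symmetric] exp_add[symmetric] by (simp add: assms(3) Suc algebra_simps)
    ultimately show ?thesis by (simp add: mult_right_mono)
  qed
  qed (use K_pos assms variance_nonneg in auto)
  also have "w ^ n = exp (- (A * u\<^sup>2 / 2))"
    unfolding w_def of_real_power[symmetric] exp_of_nat_mult[symmetric] by (simp add: assms(3) mult_ac)
  finally show ?thesis by (simp add: z_def)
qed (use assms in simp)

lemma norm_char_power_le:
  assumes "0 \<le> u" "A = real n * \<sigma>2"
  shows "cmod (char M u ^ n) \<le> exp (- (A * (u\<^sup>2 / 2 - K * u ^ 3 / 5)))"
proof -
  have "cmod (char M u ^ n) \<le> exp (- (\<sigma>2 * (u\<^sup>2 / 2 - K * u ^ 3 / 5))) ^ n"
    unfolding norm_power using norm_char_le[OF assms(1)] by (intro power_mono) auto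
  also have "\<dots> = exp (- (A * (u\<^sup>2 / 2 - K * u ^ 3 / 5)))"
    unfolding exp_of_nat_mult[symmetric] by (simp add: assms(2) mult_ac)
  finally show ?thesis .
qed

end

section \<open>Smoothing inequality\<close>

definition beurling_integrand :: "real \<Rightarrow> real \<Rightarrow> real" where
  "beurling_integrand y p = beurling_kernel y p + 2 / pi * sin (2 * y * p)"

text \<open>Linear growth in y, uniform in p, is what makes Fubini's theorem applicable under a
  finite first moment.\<close>

lemma beurling_integrand_bound:
  obtains B where "\<And>y p. p \<in> {0<..<pi} \<Longrightarrow> \<bar>beurling_integrand y p\<bar> \<le> 4 * \<bar>y\<bar> + B"
proof -
  obtain r :: "real \<Rightarrow> real" where r: "continuous_on {0..pi} r"
    and eq: "\<And>p y. p \<in> {0<..<pi} \<Longrightarrow> beurling_kernel y p = 2 * ((1 + 2 * y) * sinc ((1 + 2 * y) * p)) + r p * sin ((1 + 2 * y) * p)"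
    using beurling_kernel_sinc_decomposition by blast
  have "bounded (r ` {0..pi})" by (intro compact_imp_bounded compact_continuous_image r compact_Icc)
  then have "\<exists>R. \<forall>p\<in>{0..pi}. \<bar>r p\<bar> \<le> R" by (auto simp: bounded_iff)
  then obtain R where R: "\<And>p. p \<in> {0..pi} \<Longrightarrow> \<bar>r p\<bar> \<le> R" by blast
  have "\<bar>beurling_integrand y p\<bar> \<le> 4 * \<bar>y\<bar> + (2 + R + 2 / pi)" if p: "p \<in> {0<..<pi}" for y p
  proof -
    have tri: "\<bar>a + b + c\<bar> \<le> \<bar>a\<bar> + \<bar>b\<bar> + \<bar>c\<bar>" for a b c :: real by linarith
    have sinc: "\<bar>sinc z\<bar> \<le> 1" for z
      using abs_sin_x_le_abs_x[of z] by (auto simp: divide_le_eq)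
    have "\<bar>2 * ((1 + 2 * y) * sinc ((1 + 2 * y) * p))\<bar> \<le> 2 * ((1 + 2 * \<bar>y\<bar>) * 1)"
      unfolding abs_mult abs_numeral by (intro mult_left_mono mult_mono sinc) auto
    moreover have "\<bar>r p * sin ((1 + 2 * y) * p)\<bar> \<le> R * 1"
      unfolding abs_mult using R[of p] p by (intro mult_mono) auto
    moreover have "\<bar>2 / pi * sin (2 * y * p)\<bar> \<le> 2 / pi * 1"
      unfolding abs_mult by (intro mult_mono) auto
    ultimately have "\<bar>beurling_integrand y p\<bar> \<le> 2 * ((1 + 2 * \<bar>y\<bar>) * 1) + R * 1 + 2 / pi * 1"
      unfolding beurling_integrand_def eq[OF p] by (intro order_trans[OF tri] add_mono)
    then show ?thesis by simp
  qed
  then show ?thesis by (rule that)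
qed

lemma beurling_integrand_measurable [measurable]:
  "(\<lambda>z. beurling_integrand (f z) (g z)) \<in> borel_measurable N"
  if [measurable]: "f \<in> borel_measurable N" "g \<in> borel_measurable N"
  unfolding beurling_integrand_def beurling_kernel_def by measurable

context real_distribution
begin

text \<open>The division by 2 turns 2 y p into (x - c) p, so that p becomes the argument of the
  characteristic function.\<close>

definition beurling_expectation :: "real \<Rightarrow> real \<Rightarrow> real" where
  "beurling_expectation c p = expectation (\<lambda>x. beurling_integrand ((x - c) / 2) p)"

text \<open>The majorant at (x - c) / 2 is integrated against the distribution and the order of
  integration is exchanged. The half-line is open, so at x = c the bound - pi is enough.\<close>

lemma
  assumes int: "integrable M (\<lambda>x. x)"
  shows beurling_expectation_integrable: "beurling_expectation c integrable_on {0..pi}"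
    and prob_le_beurling_expectation:
      "pi * (2 * prob {c<..} - 1) \<le> integral {0..pi} (beurling_expectation c)"
proof -
  interpret pair_sigma_finite M lborel ..
  obtain B where B: "\<And>y p. p \<in> {0<..<pi} \<Longrightarrow> \<bar>beurling_integrand y p\<bar> \<le> 4 * \<bar>y\<bar> + B"
    by (rule beurling_integrand_bound) (rule that)
  define f where "f = (\<lambda>x p. indicator {0<..<pi} p * beurling_integrand ((x - c) / 2) p)"
  have [measurable]: "case_prod f \<in> borel_measurable (M \<Otimes>\<^sub>M lborel)"
    unfolding f_def by measurable
  have f_le: "\<bar>f x p\<bar> \<le> indicator {0<..<pi} p * (4 * \<bar>(x - c) / 2\<bar> + B)" for x p
    using B[of p "(x - c) / 2"] by (auto simp: f_def indicator_def)
  have int_bound: "integrable lborel (\<lambda>p. indicator {0<..<pi} p * (C::real))" for C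
    by simp
  have f_int: "integrable lborel (f x)" for x
  proof (rule Bochner_Integration.integrable_bound[OF int_bound])
    show "f x \<in> borel_measurable lborel" unfolding f_def by measurable
    show "AE p in lborel. norm (f x p) \<le> norm (indicator {0<..<pi} p * (4 * \<bar>(x - c) / 2\<bar> + B))"
      using order_trans[OF f_le abs_ge_self] by (intro AE_I2) (simp only: real_norm_def)
  qed
  have f_norm_le: "(\<integral>p. norm (f x p) \<partial>lborel) \<le> pi * (4 * \<bar>(x - c) / 2\<bar> + B)" for x
  proof -
    have "(\<integral>p. norm (f x p) \<partial>lborel) \<le> (\<integral>p. indicator {0<..<pi} p * (4 * \<bar>(x - c) / 2\<bar> + B) \<partial>lborel)"
      using f_int f_le int_bound by (intro integral_mono) auto
    also have "\<dots> = pi * (4 * \<bar>(x - c) / 2\<bar> + B)" by simp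
    finally show ?thesis .
  qed
  have "integrable (M \<Otimes>\<^sub>M lborel) (case_prod f)"
  proof (rule Fubini_integrable)
    have "integrable M (\<lambda>x. pi * (4 * \<bar>(x - c) / 2\<bar> + B))" using int by simp
    then show "integrable M (\<lambda>x. \<integral>p. norm (case_prod f (x, p)) \<partial>lborel)"
    proof (rule Bochner_Integration.integrable_bound)
      show "AE x in M. norm (\<integral>p. norm (case_prod f (x, p)) \<partial>lborel) \<le> norm (pi * (4 * \<bar>(x - c) / 2\<bar> + B))"
      proof (rule AE_I2)
        fix x
        have "norm (\<integral>p. norm (case_prod f (x, p)) \<partial>lborel) = (\<integral>p. norm (f x p) \<partial>lborel)" by simp
        also have "\<dots> \<le> norm (pi * (4 * \<bar>(x - c) / 2\<bar> + B))"
          using order_trans[OF f_norm_le abs_ge_self] by (simp only: real_norm_def)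
        finally show "norm (\<integral>p. norm (case_prod f (x, p)) \<partial>lborel) \<le> norm (pi * (4 * \<bar>(x - c) / 2\<bar> + B))" .
      qed
    qed measurable
  qed (use f_int in auto)
  note fub = this
  have inner_p: "(\<integral>p. f x p \<partial>lborel) = beurling ((x - c) / 2)" for x
  proof -
    have si: "set_integrable lborel {0<..<pi} (beurling_integrand ((x - c) / 2))"
      using f_int[of x] by (simp add: f_def set_integrable_def)
    have "(\<integral>p. f x p \<partial>lborel) = (LINT p:{0<..<pi}|lborel. beurling_integrand ((x - c) / 2) p)"
      by (simp add: f_def set_lebesgue_integral_def)
    also have "\<dots> = integral {0<..<pi} (beurling_integrand ((x - c) / 2))"
      by (rule set_borel_integral_eq_integral(2)[OF si])
    also have "\<dots> = integral {0..pi} (beurling_integrand ((x - c) / 2))"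
      by (rule integral_open_interval_real[symmetric])
    finally show ?thesis by (simp add: beurling_def beurling_integrand_def[abs_def])
  qed
  have inner_x: "(\<integral>x. f x p \<partial>M) = indicator {0<..<pi} p * beurling_expectation c p" for p
    by (simp add: f_def beurling_expectation_def)
  have "integrable lborel (\<lambda>p. \<integral>x. f x p \<partial>M)"
    by (rule integrable_snd[OF fub])
  then have si: "set_integrable lborel {0<..<pi} (beurling_expectation c)"
    by (simp add: inner_x set_integrable_def)
  show "beurling_expectation c integrable_on {0..pi}"
    using set_borel_integral_eq_integral(1)[OF si] by (simp add: integrable_on_open_interval_real)
  have "pi * (2 * prob {c<..} - 1) = expectation (\<lambda>x. pi * (2 * indicator {c<..} x - 1))"
  proof -
    have "integrable M (\<lambda>x. indicator {c<..} x :: real)"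
      by (intro integrable_const_bound[of _ 1]) auto
    then show ?thesis using prob_space by (simp add: Bochner_Integration.integral_diff)
  qed
  also have "\<dots> \<le> expectation (\<lambda>x. \<integral>p. f x p \<partial>lborel)"
  proof (rule integral_mono)
    show "integrable M (\<lambda>x. \<integral>p. f x p \<partial>lborel)" by (rule integrable_fst[OF fub])
    fix x :: real
    show "pi * (2 * indicator {c<..} x - 1) \<le> (\<integral>p. f x p \<partial>lborel)"
      using beurling_ge_pi[of "(x - c) / 2"] beurling_ge_minus_pi[of "(x - c) / 2"]
      by (auto simp: inner_p indicator_def)
  qed (auto intro!: integrable_const_bound[of _ 1] simp: indicator_def)
  also have "\<dots> = (\<integral>p. (\<integral>x. f x p \<partial>M) \<partial>lborel)"
    by (rule Fubini_integral[OF fub, symmetric])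
  also have "\<dots> = (LINT p:{0<..<pi}|lborel. beurling_expectation c p)"
    by (simp add: inner_x set_lebesgue_integral_def)
  also have "\<dots> = integral {0<..<pi} (beurling_expectation c)"
    by (rule set_borel_integral_eq_integral(2)[OF si])
  also have "\<dots> = integral {0..pi} (beurling_expectation c)"
    by (rule integral_open_interval_real[symmetric])
  finally show "pi * (2 * prob {c<..} - 1) \<le> integral {0..pi} (beurling_expectation c)" .
qed

end

text \<open>Both sine terms of the integrand contain the phase (x - c) p. Collecting everything
  independent of x in one complex factor leaves only iexp (p x) under the expectation, which yields
  the characteristic function.\<close>

definition beurling_weight :: "real \<Rightarrow> real \<Rightarrow> complex" where
  "beurling_weight c p = iexp (- (c * p)) * (complex_of_real (2 * (1 - p / pi) / sin p) * iexp p + complex_of_real (2 / pi))"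

lemma beurling_integrand_eq_Im:
  "beurling_integrand ((x - c) / 2) p = Im (iexp (p * x) * beurling_weight c p)"
proof -
  have "iexp (p * x) * beurling_weight c p =
      complex_of_real (2 * (1 - p / pi) / sin p) * cis ((x - c) * p + p) + complex_of_real (2 / pi) * cis ((x - c) * p)"
  proof -
    define a where "a = complex_of_real (2 * (1 - p / pi) / sin p)"
    have "iexp (p * x) * beurling_weight c p = a * (cis (p * x) * cis (- (c * p)) * cis p) + complex_of_real (2 / pi) * (cis (p * x) * cis (- (c * p)))"
      unfolding beurling_weight_def cis_conv_exp a_def[symmetric] by (simp only: ring_distribs mult_ac)
    then show ?thesis
      by (simp add: cis_mult a_def left_diff_distrib mult.commute[of x p])
  qed
  moreover have "2 * ((x - c) / 2) = x - c" by simp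
  then have args: "(1 + 2 * ((x - c) / 2)) * p = (x - c) * p + p" "2 * ((x - c) / 2) * p = (x - c) * p"
    by (simp_all only: distrib_right mult_1_left add.commute)
  ultimately show ?thesis
    unfolding beurling_integrand_def beurling_kernel_def args by simp
qed

lemma (in real_distribution) beurling_expectation_eq_Im:
  "beurling_expectation c p = Im (char M p * beurling_weight c p)"
proof -
  have int: "integrable M (\<lambda>x. iexp (p * x))"
    by (rule integrable_iexp) auto
  have "beurling_expectation c p = expectation (\<lambda>x. Im (iexp (p * x) * beurling_weight c p))"
    by (simp only: beurling_expectation_def beurling_integrand_eq_Im)
  also have "\<dots> = Im (CLINT x|M. iexp (p * x) * beurling_weight c p)"
    by (rule integral_Im) (use int in simp)
  also have "(CLINT x|M. iexp (p * x) * beurling_weight c p) = char M p * beurling_weight c p"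
    unfolding char_def using int by simp
  finally show ?thesis .
qed

text \<open>The point c enters only as a phase, so it disappears from the modulus.\<close>

lemma norm_beurling_weight:
  assumes "sin p \<noteq> 0"
  shows "(cmod (beurling_weight c p))\<^sup>2 = (2 * (1 - p / pi) * cos p / sin p + 2 / pi)\<^sup>2 + (2 * (1 - p / pi))\<^sup>2"
proof -
  have "cmod (beurling_weight c p) = cmod (complex_of_real (2 * (1 - p / pi) / sin p) * cis p + complex_of_real (2 / pi))"
    by (simp add: beurling_weight_def norm_mult flip: cis_conv_exp)
  then show ?thesis using assms by (simp add: cmod_power2)
qed

text \<open>After \<open>x_cos_le\<close>, the squared modulus times p^2 is at most 4 plus a
  polynomial in s = p / pi and pi^2. This excess stays below 0.41, the difference between (21/10)^2
  and 4.\<close>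

lemma norm_beurling_weight_near_0:
  assumes "0 < p" "p \<le> 4/3"
  shows "cmod (beurling_weight c p) \<le> 21/10 / p"
proof -
  have pi: "pi \<ge> 314/100" "pi \<le> 3142/1000" using pi_approx by auto
  have sin: "sin p > 0" using assms pi by (intro sin_gt_zero) auto
  have cos: "cos p \<ge> 0" using assms pi by (intro cos_ge_zero) auto
  define s where "s = p / pi"
  have s: "0 < s" "s \<le> 1/2" using assms pi by (auto simp: s_def field_simps)
  have p: "p = pi * s" by (simp add: s_def)
  define X where "X = p * (2 * (1 - s) * cos p / sin p + 2 / pi)"
  have "X \<ge> 0" using assms sin cos s by (simp add: X_def)
  have "p * cos p / sin p \<le> 1 - p\<^sup>2 / 3"
    using x_cos_le[of p] sin assms pi by (simp add: field_simps)
  then have "2 * (1 - s) * (p * cos p / sin p) \<le> 2 * (1 - s) * (1 - p\<^sup>2 / 3)"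
    using s by (intro mult_left_mono) auto
  moreover have "X = 2 * (1 - s) * (p * cos p / sin p) + 2 * s"
    by (simp add: X_def s_def field_simps)
  ultimately have X_le: "X \<le> 2 - 2/3 * (1 - s) * p\<^sup>2" by (simp add: algebra_simps)
  have "(p * cmod (beurling_weight c p))\<^sup>2 = X\<^sup>2 + (2 * (1 - s) * p)\<^sup>2"
    unfolding power_mult_distrib norm_beurling_weight[OF less_imp_neq[OF sin, symmetric]] X_def s_def
    by (simp add: power_mult_distrib algebra_simps)
  also have "\<dots> \<le> (2 - 2/3 * (1 - s) * p\<^sup>2)\<^sup>2 + (2 * (1 - s) * p)\<^sup>2"
    using X_le \<open>X \<ge> 0\<close> by (intro add_right_mono power_mono) auto
  also have "\<dots> = 4 + 4 * (pi\<^sup>2 * ((s * (1 - s)) * (s * (1/3 - s + pi\<^sup>2 / 9 * (s * (s * (1 - s)))))))"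
    by (simp add: p power2_eq_square field_simps)
  also have "\<dots> \<le> 4 + 4 * (988/100 * (1/4 * (39/1000)))"
  proof -
    have pi2: "pi\<^sup>2 \<le> 988/100"
      using mult_mono[of pi "3142/1000" pi "3142/1000"] pi by (simp add: power2_eq_square)
    have quarter: "s * (1 - s) \<le> 1/4"
      using zero_le_power2[of "s - 1/2"] by (simp add: power2_eq_square algebra_simps)
    have nn: "0 \<le> s * (1 - s)" using s by simp
    have "pi\<^sup>2 / 9 * (s * (s * (1 - s))) \<le> 988/900 * (s * (1/4))"
      using pi2 quarter s nn by (intro mult_mono) auto
    then have "1/3 - s + pi\<^sup>2 / 9 * (s * (s * (1 - s))) \<le> 1/3 - 72/100 * s"
      using s by linarith
    then have "s * (1/3 - s + pi\<^sup>2 / 9 * (s * (s * (1 - s)))) \<le> s * (1/3 - 72/100 * s)"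
      using s by (intro mult_left_mono) auto
    \<comment> \<open>The quadratic in s attains its maximum at 25/108.\<close>
    also have "\<dots> \<le> 39/1000"
      using zero_le_power2[of "s - 25/108"] by (simp add: power2_eq_square algebra_simps)
    finally have b: "s * (1/3 - s + pi\<^sup>2 / 9 * (s * (s * (1 - s)))) \<le> 39/1000" .
    have "(s * (1 - s)) * (s * (1/3 - s + pi\<^sup>2 / 9 * (s * (s * (1 - s))))) \<le> (s * (1 - s)) * (39/1000)"
      using b nn by (rule mult_left_mono)
    also have "\<dots> \<le> 1/4 * (39/1000)" using quarter by (intro mult_right_mono) auto
    finally have "(s * (1 - s)) * (s * (1/3 - s + pi\<^sup>2 / 9 * (s * (s * (1 - s))))) \<le> 1/4 * (39/1000)" .
    then have "pi\<^sup>2 * ((s * (1 - s)) * (s * (1/3 - s + pi\<^sup>2 / 9 * (s * (s * (1 - s)))))) \<le> pi\<^sup>2 * (1/4 * (39/1000))"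
      by (intro mult_left_mono) auto
    also have "\<dots> \<le> 988/100 * (1/4 * (39/1000))" using pi2 by (intro mult_right_mono) auto
    finally show ?thesis by linarith
  qed
  also have "\<dots> \<le> (21/10)\<^sup>2" by (simp add: power2_eq_square)
  finally have "p * cmod (beurling_weight c p) \<le> 21/10" by (rule power2_le_imp_le) simp
  then show ?thesis using assms by (simp add: field_simps)
qed

text \<open>The weight vanishes linearly at pi. With x = pi - p the cotangent changes sign, and the
  first square becomes that of 2 / pi (1 - x cot x), which \<open>x_cos_le\<close> and
  \<open>x_cos_ge\<close> place between 0 and x^2 / pi.\<close>

lemma norm_beurling_weight_near_pi:
  assumes "4/3 \<le> p" "p < pi"
  shows "cmod (beurling_weight c p) \<le> 27 / (10 * pi) * (pi - p)"
proof -
  define x where "x = pi - p"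
  have x: "0 < x" "x \<le> 181/100" using assms pi_approx by (auto simp: x_def)
  have p: "p = pi - x" by (simp add: x_def)
  have "x \<le> pi" using assms by (simp add: x_def)
  have sin: "sin x > 0" using x \<open>x \<le> pi\<close> assms by (intro sin_gt_zero) (auto simp: x_def)
  define X where "X = 1 - x * cos x / sin x"
  have "x * cos x / sin x \<le> 1 - x\<^sup>2 / 3"
    using x_cos_le[of x] sin x \<open>x \<le> pi\<close> by (simp add: field_simps)
  then have "X \<ge> 0" using zero_le_power2[of x] unfolding X_def by linarith
  have "1 - x\<^sup>2 / 2 \<le> x * cos x / sin x"
    using x_cos_ge[of x] sin x by (simp add: field_simps)
  then have "X \<le> x\<^sup>2 / 2" unfolding X_def by linarith
  have "sin p \<noteq> 0" using sin by (simp add: p)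
  have v: "1 - p / pi = x / pi" by (simp add: p field_simps)
  have "(cmod (beurling_weight c p))\<^sup>2 = (2 / pi * X)\<^sup>2 + (2 / pi * x)\<^sup>2"
    unfolding norm_beurling_weight[OF \<open>sin p \<noteq> 0\<close>] v X_def by (simp add: p field_simps)
  also have "\<dots> \<le> (2 / pi * (x\<^sup>2 / 2))\<^sup>2 + (2 / pi * x)\<^sup>2"
    using \<open>X \<ge> 0\<close> \<open>X \<le> x\<^sup>2 / 2\<close> by (intro add_right_mono power_mono mult_left_mono) auto
  also have "\<dots> = (2 / pi * x)\<^sup>2 * (1 + x\<^sup>2 / 4)"
    by (simp add: power2_eq_square field_simps)
  also have "\<dots> \<le> (2 / pi * x)\<^sup>2 * (27/20)\<^sup>2"
  proof (intro mult_left_mono)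
    have "x\<^sup>2 \<le> (181/100)\<^sup>2" using x by (intro power_mono) auto
    then show "1 + x\<^sup>2 / 4 \<le> (27/20)\<^sup>2" by (simp add: power2_eq_square)
  qed simp
  also have "\<dots> = (27 / (10 * pi) * (pi - p))\<^sup>2"
    by (simp add: x_def power2_eq_square field_simps)
  finally show ?thesis by (rule power2_le_imp_le) (use assms in simp)
qed

text \<open>At c = 3/2 the first term has phase - p / 2, and the half-angle formula turns its
  contribution into (1 - p / pi) / cos (p / 2), at least 1 - p / pi. The cubic bound for sin (3/2 p)
  supplies 3 p / pi and the coefficient 9/16.\<close>

lemma Im_beurling_weight_le:
  assumes "0 < p" "p \<le> 4/3"
  shows "Im (beurling_weight (3/2) p) \<le> - (1 + 2 / pi * (p - 9/16 * p ^ 3))"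
proof -
  have pi: "pi \<ge> 3" using pi_approx by simp
  have c: "0 < cos (p / 2)" using assms pi by (intro cos_gt_zero) auto
  have s: "0 < sin (p / 2)" using assms pi by (intro sin_gt_zero) auto
  have "sin p = 2 * sin (p / 2) * cos (p / 2)" using sin_double[of "p / 2"] by simp
  moreover have "2 * v / (2 * sin (p / 2) * cos (p / 2)) * sin (p / 2) = v / cos (p / 2)" for v
    using s c by (simp add: field_simps)
  ultimately have eq: "2 * (1 - p / pi) / sin p * sin (p / 2) = (1 - p / pi) / cos (p / 2)"
    by (simp only:)
  have Im: "Im (beurling_weight (3/2) p) = - (2 * (1 - p / pi) / sin p * sin (p / 2) + 2 / pi * sin (3/2 * p))"
  proof -
    have "beurling_weight (3/2) p =
      complex_of_real (2 * (1 - p / pi) / sin p) * cis (- (p / 2)) + complex_of_real (2 / pi) * cis (- (3/2 * p))"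
    proof -
      define a where "a = complex_of_real (2 * (1 - p / pi) / sin p)"
      have "beurling_weight (3/2) p = a * (cis (- (3/2 * p)) * cis p) + complex_of_real (2 / pi) * cis (- (3/2 * p))"
        unfolding beurling_weight_def cis_conv_exp a_def[symmetric] by (simp only: ring_distribs mult_ac)
      then show ?thesis by (simp add: cis_mult a_def)
    qed
    then show ?thesis by simp
  qed
  have "1 + 2 / pi * (p - 9/16 * p ^ 3) = (1 - p / pi) / 1 + 2 / pi * (3/2 * p - (3/2 * p) ^ 3 / 6)"
    by (simp add: power3_eq_cube field_simps)
  also have "\<dots> \<le> (1 - p / pi) / cos (p / 2) + 2 / pi * sin (3/2 * p)"
  proof (intro add_mono mult_left_mono)
    show "(1 - p / pi) / 1 \<le> (1 - p / pi) / cos (p / 2)"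
      using assms pi c by (intro divide_left_mono) auto
    have "\<bar>3/2 * p\<bar> = 3/2 * p" using assms by simp
    then show "3/2 * p - (3/2 * p) ^ 3 / 6 \<le> sin (3/2 * p)"
      using abs_sin_diff_le[of "3/2 * p"] by linarith
  qed simp
  finally show ?thesis unfolding Im eq by simp
qed

section \<open>Estimating the smoothed integral\<close>

text \<open>Beyond b one has 1 \<le> p / b, and p exp (- m p^2) integrates in closed form. The tail
  is represented as the half-line function \<open>h\<close> minus its truncation
  \<open>k\<close>.\<close>

lemma gaussian_truncated_bounds:
  fixes m b :: real
  assumes "m > 0" "b > 0"
  shows "integral {0..b} (\<lambda>p. exp (- (m * p\<^sup>2))) \<le> sqrt (pi / m) / 2"
    and "sqrt (pi / m) / 2 - exp (- (m * b\<^sup>2)) / (2 * m * b) \<le> integral {0..b} (\<lambda>p. exp (- (m * p\<^sup>2)))"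
proof -
  define I where "I = integral {0..b} (\<lambda>p. exp (- (m * p\<^sup>2)))"
  define f where "f = (\<lambda>p::real. indicator {0..} p *\<^sub>R exp (- (m * p\<^sup>2)))"
  define g where "g = (\<lambda>p::real. indicator {0..b} p *\<^sub>R exp (- (m * p\<^sup>2)))"
  define h where "h = (\<lambda>p::real. indicator {0..} p *\<^sub>R (p * exp (- (m * p\<^sup>2))))"
  define k where "k = (\<lambda>p::real. indicator {0..b} p *\<^sub>R (p * exp (- (m * p\<^sup>2))))"
  have scale: "indicator {0..} (0 + sqrt m * p) = (indicator {0..} p :: real)" for p
    using assms by (simp add: indicator_def zero_le_mult_iff)
  have "has_bochner_integral lborel (\<lambda>p. indicator {0..} (0 + sqrt m * p) *\<^sub>R exp (- (0 + sqrt m * p)\<^sup>2)) ((sqrt pi / 2) /\<^sub>R \<bar>sqrt m\<bar>)"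
    using lborel_has_bochner_integral_real_affine_iff[of "sqrt m" "\<lambda>x. indicator {0..} x *\<^sub>R exp (- x\<^sup>2)" "sqrt pi / 2" 0]
      gaussian_moment_0 assms by simp
  moreover have "(sqrt pi / 2) /\<^sub>R \<bar>sqrt m\<bar> = sqrt (pi / m) / 2"
    using assms by (simp add: real_sqrt_divide field_simps)
  ultimately have f: "has_bochner_integral lborel f (sqrt (pi / m) / 2)"
    unfolding scale using assms by (simp only: f_def) (simp add: power_mult_distrib)
  have "has_bochner_integral lborel (\<lambda>p. indicator {0..} (0 + sqrt m * p) *\<^sub>R (exp (- (0 + sqrt m * p)\<^sup>2) * (0 + sqrt m * p))) ((1 / 2) /\<^sub>R \<bar>sqrt m\<bar>)"
    using lborel_has_bochner_integral_real_affine_iff[of "sqrt m" "\<lambda>x. indicator {0..} x *\<^sub>R (exp (- x\<^sup>2) * x)" "1 / 2" 0]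
      gaussian_moment_1 assms by simp
  then have "has_bochner_integral lborel (\<lambda>p. sqrt m * h p) (1 / (2 * sqrt m))"
    unfolding scale using assms by (simp add: h_def power_mult_distrib mult_ac inverse_eq_divide)
  then have "has_bochner_integral lborel (\<lambda>p. inverse (sqrt m) * (sqrt m * h p)) (inverse (sqrt m) * (1 / (2 * sqrt m)))"
    by (rule has_bochner_integral_mult_right)
  moreover have "inverse (sqrt m) * (sqrt m * h p) = h p" for p using assms by simp
  moreover have "inverse (sqrt m) * (1 / (2 * sqrt m)) = 1 / (2 * m)"
  proof -
    have "inverse (sqrt m) * (1 / (2 * sqrt m)) = 1 / (2 * (sqrt m * sqrt m))"
      by (simp only: inverse_eq_divide times_divide_times_eq mult_1 mult.left_commute)
    then show ?thesis using assms by simp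
  qed
  ultimately have h: "has_bochner_integral lborel h (1 / (2 * m))" by (simp only:)
  have g: "has_bochner_integral lborel g I"
  proof -
    have "set_integrable lborel {0..b} (\<lambda>p. exp (- (m * p\<^sup>2)))"
      by (intro borel_integrable_atLeastAtMost' continuous_intros)
    from this set_borel_integral_eq_integral(2)[OF this] show ?thesis
      by (simp add: g_def I_def has_bochner_integral_iff set_integrable_def set_lebesgue_integral_def)
  qed
  have k: "has_bochner_integral lborel k ((1 - exp (- (m * b\<^sup>2))) / (2 * m))"
  proof -
    have "((\<lambda>p. p * exp (- (m * p\<^sup>2))) has_integral - exp (- (m * b\<^sup>2)) / (2 * m) - - exp (- (m * 0\<^sup>2)) / (2 * m)) {0..b}"
    proof (rule fundamental_theorem_of_calculus)
      fix p assume "p \<in> {0..b}"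
      have "((\<lambda>p. - exp (- (m * p\<^sup>2)) / (2 * m)) has_real_derivative p * exp (- (m * p\<^sup>2))) (at p within {0..b})"
        using assms by (auto intro!: derivative_eq_intros simp: field_simps)
      then show "((\<lambda>p. - exp (- (m * p\<^sup>2)) / (2 * m)) has_vector_derivative p * exp (- (m * p\<^sup>2))) (at p within {0..b})"
        by (simp only: has_real_derivative_iff_has_vector_derivative)
    qed (use assms in simp)
    then have "integral {0..b} (\<lambda>p. p * exp (- (m * p\<^sup>2))) = (1 - exp (- (m * b\<^sup>2))) / (2 * m)"
      by (simp add: integral_unique diff_divide_distrib)
    moreover have si: "set_integrable lborel {0..b} (\<lambda>p. p * exp (- (m * p\<^sup>2)))"
      by (intro borel_integrable_atLeastAtMost' continuous_intros)
    ultimately show ?thesis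
      using set_borel_integral_eq_integral(2)[OF si]
      by (simp add: k_def has_bochner_integral_iff set_integrable_def set_lebesgue_integral_def)
  qed
  have mono: "x \<le> y" if "has_bochner_integral lborel u x" "has_bochner_integral lborel v y" "\<And>p. u p \<le> v p"
    for u v :: "real \<Rightarrow> real" and x y
    using integral_mono[of lborel u v] that by (simp add: has_bochner_integral_iff)
  have "I \<le> sqrt (pi / m) / 2"
    using g f by (rule mono) (auto simp: f_def g_def indicator_def)
  moreover have "sqrt (pi / m) / 2 \<le> I + (1 / (2 * m) - (1 - exp (- (m * b\<^sup>2))) / (2 * m)) / b"
  proof (rule mono[OF f])
    show "has_bochner_integral lborel (\<lambda>p. g p + (h p - k p) / b) (I + (1 / (2 * m) - (1 - exp (- (m * b\<^sup>2))) / (2 * m)) / b)"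
      by (intro has_bochner_integral_add has_bochner_integral_divide has_bochner_integral_diff g h k)
    show "f p \<le> g p + (h p - k p) / b" for p
      using assms by (auto simp: f_def g_def h_def k_def indicator_def field_simps)
  qed
  ultimately show "integral {0..b} (\<lambda>p. exp (- (m * p\<^sup>2))) \<le> sqrt (pi / m) / 2"
    and "sqrt (pi / m) / 2 - exp (- (m * b\<^sup>2)) / (2 * m * b) \<le> integral {0..b} (\<lambda>p. exp (- (m * p\<^sup>2)))"
    unfolding I_def[symmetric] by (simp_all add: diff_divide_distrib)
qed

lemma has_integral_gaussian_second_moment:
  fixes m b :: real
  assumes "m > 0" "b \<ge> 0"
  shows "((\<lambda>p. p\<^sup>2 * exp (- (m * p\<^sup>2))) has_integral
    (integral {0..b} (\<lambda>p. exp (- (m * p\<^sup>2))) - b * exp (- (m * b\<^sup>2))) / (2 * m)) {0..b}"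
proof -
  let ?F = "\<lambda>p. - (p * exp (- (m * p\<^sup>2))) / (2 * m)"
  have "((\<lambda>p. p\<^sup>2 * exp (- (m * p\<^sup>2)) - exp (- (m * p\<^sup>2)) / (2 * m)) has_integral ?F b - ?F 0) {0..b}"
  proof (rule fundamental_theorem_of_calculus)
    fix p assume "p \<in> {0..b}"
    have "(?F has_real_derivative p\<^sup>2 * exp (- (m * p\<^sup>2)) - exp (- (m * p\<^sup>2)) / (2 * m)) (at p within {0..b})"
      using assms by (auto intro!: derivative_eq_intros simp: field_simps power2_eq_square)
    then show "(?F has_vector_derivative p\<^sup>2 * exp (- (m * p\<^sup>2)) - exp (- (m * p\<^sup>2)) / (2 * m)) (at p within {0..b})"
      by (simp only: has_real_derivative_iff_has_vector_derivative)
  qed (use assms in simp)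
  moreover have "((\<lambda>p. exp (- (m * p\<^sup>2)) / (2 * m)) has_integral integral {0..b} (\<lambda>p. exp (- (m * p\<^sup>2))) / (2 * m)) {0..b}"
    by (intro has_integral_divide integrable_integral integrable_continuous_interval continuous_intros)
  ultimately have "((\<lambda>p. p\<^sup>2 * exp (- (m * p\<^sup>2)) - exp (- (m * p\<^sup>2)) / (2 * m) + exp (- (m * p\<^sup>2)) / (2 * m)) has_integral
    ?F b - ?F 0 + integral {0..b} (\<lambda>p. exp (- (m * p\<^sup>2))) / (2 * m)) {0..b}"
    by (rule has_integral_add)
  then show ?thesis by (simp add: diff_divide_distrib)
qed

lemma has_integral_gaussian_odd_moments:
  fixes A b :: real
  assumes "A > 0" "b \<ge> 0"
  shows "((\<lambda>p. exp (- (A * p\<^sup>2 / 2)) * (p - c * p ^ 3)) has_integral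
    exp (- (A * b\<^sup>2 / 2)) * (- 1 / A + c * (b\<^sup>2 / A + 2 / A\<^sup>2)) - (- 1 / A + c * (2 / A\<^sup>2))) {0..b}"
proof -
  let ?F = "\<lambda>p. exp (- (A * p\<^sup>2 / 2)) * (- 1 / A + c * (p\<^sup>2 / A + 2 / A\<^sup>2))"
  have "((\<lambda>p. exp (- (A * p\<^sup>2 / 2)) * (p - c * p ^ 3)) has_integral ?F b - ?F 0) {0..b}"
  proof (rule fundamental_theorem_of_calculus)
    fix p assume "p \<in> {0..b}"
    have "(?F has_real_derivative exp (- (A * p\<^sup>2 / 2)) * (p - c * p ^ 3)) (at p within {0..b})"
    proof -
      have "(?F has_real_derivative exp (- (A * p\<^sup>2 / 2)) * (- (A * p)) * (- 1 / A + c * (p\<^sup>2 / A + 2 / A\<^sup>2))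
          + exp (- (A * p\<^sup>2 / 2)) * (c * (2 * p / A))) (at p within {0..b})"
        using assms by (auto intro!: derivative_eq_intros)
      moreover have "- (A * p) * (- 1 / A + c * (p\<^sup>2 / A + 2 / A\<^sup>2)) + c * (2 * p / A) = p - c * p ^ 3"
        using assms by (simp add: field_simps power2_eq_square power3_eq_cube)
      ultimately show ?thesis by (simp only: mult.assoc distrib_left[symmetric])
    qed
    then show "(?F has_vector_derivative exp (- (A * p\<^sup>2 / 2)) * (p - c * p ^ 3)) (at p within {0..b})"
      by (simp only: has_real_derivative_iff_has_vector_derivative)
  qed (use assms in simp)
  then show ?thesis by simp
qed

lemma integral_le_has_integral_spike:
  fixes f g :: "real \<Rightarrow> real"
  assumes f: "f integrable_on S" and g: "(g has_integral G) S" and "finite F"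
    and le: "\<And>x. x \<in> S - F \<Longrightarrow> f x \<le> g x"
  shows "integral S f \<le> G"
proof -
  define f' where "f' = (\<lambda>x. if x \<in> F then g x else f x)"
  have "(f' has_integral integral S f) S"
    by (rule has_integral_spike_finite[OF \<open>finite F\<close> _ integrable_integral[OF f]]) (simp add: f'_def)
  then show ?thesis using g by (rule has_integral_le) (use le in \<open>auto simp: f'_def\<close>)
qed

lemma has_integral_const_minus:
  fixes a b d :: real
  assumes "a \<le> b"
  shows "((\<lambda>p. C * (d - p)) has_integral C * ((d - a)\<^sup>2 - (d - b)\<^sup>2) / 2) {a..b}"
proof -
  have "((\<lambda>p. C * (d - p)) has_integral - (C * (d - b)\<^sup>2 / 2) - - (C * (d - a)\<^sup>2 / 2)) {a..b}"
  proof (rule fundamental_theorem_of_calculus[OF assms])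
    fix p
    have "((\<lambda>p. - (C * (d - p)\<^sup>2 / 2)) has_real_derivative C * (d - p)) (at p within {a..b})"
      by (auto intro!: derivative_eq_intros simp: field_simps)
    then show "((\<lambda>p. - (C * (d - p)\<^sup>2 / 2)) has_vector_derivative C * (d - p)) (at p within {a..b})"
      by (simp only: has_real_derivative_iff_has_vector_derivative)
  qed
  then show ?thesis by (simp add: algebra_simps diff_divide_distrib)
qed

section \<open>Numerical comparison of the gain with the losses\<close>

lemma exp_numeric_bounds:
  "exp (- (6/5)) \<le> (32/100 :: real)" "18/100 \<le> exp (- (8/5) :: real)" "exp (- (63/100)) \<le> (55/100 :: real)"
  "exp (- 2) \<le> (152/1000 :: real)" "exp (- (21/10)) \<le> (1/4 :: real)"
proof -
  have *: "exp (- x) \<le> 1 / y" if "y \<le> (1 + x / real n) ^ n" "0 < y" "0 < n" "0 \<le> x" for x y :: real and n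
  proof -
    have "(1 + x / real n) ^ n \<le> exp x"
      using that by (intro exp_ge_one_plus_x_over_n_power_n) auto
    with that have "y \<le> exp x" by linarith
    then have "1 / exp x \<le> 1 / y" using that by (intro divide_left_mono) auto
    then show ?thesis by (simp add: exp_minus inverse_eq_divide)
  qed
  show "exp (- (6/5)) \<le> (32/100 :: real)" using *[of "100/32" "6/5" 16] by (simp add: power_divide)
  show "exp (- (63/100)) \<le> (55/100 :: real)" using *[of "100/55" "63/100" 8] by (simp add: power_divide)
  show "exp (- 2) \<le> (152/1000 :: real)" using *[of "1000/152" "2" 16] by (simp add: power_divide)
  show "exp (- (21/10)) \<le> (1/4 :: real)" using *[of "4" "21/10" 4] by (simp add: power_divide)
  show "18/100 \<le> exp (- (8/5) :: real)"
    using exp_ge_one_minus_x_over_n_power_n[of "8/5" 16] by (simp add: power_divide)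
qed

text \<open>On the right stand the slack of the leading terms, the gain from the odd Gaussian
  moments, and the credit for truncating the second moment in the error term. The inequality is
  already multiplied by r = sqrt A.\<close>

lemma smoothing_terms_numeric:
  fixes r :: real
  assumes "r \<ge> 3/2" and A: "A = r\<^sup>2"
  shows "3/4 / r * exp (- (8/9 * A)) + r * (1309/1000 * exp (- (8/15 * A)) + 1/10 * exp (- (7/25 * A)))
    \<le> 3905/10000 + 6366/10000 * (r\<^sup>2 - 9/8) / r ^ 3 + r * (82/100 * exp (- (32/45 * A)))"
proof -
  define W where "W = A - 9/4"
  have "r > 0" using assms by simp
  have "(3/2)\<^sup>2 \<le> r\<^sup>2" using assms by (intro power_mono) auto
  then have W: "W \<ge> 0" by (simp add: W_def A power2_eq_square)
  \<comment> \<open>14/45 = 8/15 - 2/9 is what remains of the rate 8/15 once the factor r has been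
    bounded by 3/2 exp (2/9 W).\<close>
  define q where "q = exp (- (14/45 * W))"
  have q: "0 < q" "q \<le> 1" using W by (auto simp: q_def)
  have r_le: "r \<le> 3/2 * exp (2/9 * W)"
  proof (rule power2_le_imp_le)
    have "r\<^sup>2 = 9/4 + W" by (simp add: W_def A)
    also have "\<dots> = 9/4 * (1 + 4/9 * W)" by simp
    also have "\<dots> \<le> 9/4 * exp (4/9 * W)" using exp_ge_add_one_self by (intro mult_left_mono) auto
    also have "\<dots> = (3/2 * exp (2/9 * W))\<^sup>2"
      by (simp add: power_mult_distrib power2_eq_square flip: exp_add)
    finally show "r\<^sup>2 \<le> (3/2 * exp (2/9 * W))\<^sup>2" .
  qed simp
  have t1: "3/4 / r * exp (- (8/9 * A)) \<le> 76/1000"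
  proof -
    have "3/4 / r \<le> 1/2" using assms by (simp add: field_simps)
    moreover have "exp (- (8/9 * A)) \<le> exp (- 2)" using W by (simp add: W_def)
    then have "exp (- (8/9 * A)) \<le> 152/1000" using exp_numeric_bounds(4) by linarith
    ultimately have "3/4 / r * exp (- (8/9 * A)) \<le> 1/2 * (152/1000)"
      using \<open>r > 0\<close> by (intro mult_mono) auto
    then show ?thesis by simp
  qed
  have t2: "r * exp (- (8/15 * A)) \<le> 48/100 * q"
  proof -
    have "r * exp (- (8/15 * A)) \<le> 3/2 * exp (2/9 * W) * exp (- (8/15 * A))"
      using r_le by (intro mult_right_mono) auto
    also have "\<dots> = 3/2 * exp (- (6/5)) * q"
      unfolding q_def W_def mult.assoc exp_add[symmetric] by (simp add: field_simps)
    also have "\<dots> \<le> 3/2 * (32/100) * q"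
      using exp_numeric_bounds(1) q by (intro mult_right_mono) auto
    finally show ?thesis by simp
  qed
  \<comment> \<open>The credit is expressed through a power of q so that it can be weighed against
    \<open>t2\<close>; the rate 14/15 of q^3 exceeds 32/45.\<close>
  have t3: "r * exp (- (32/45 * A)) \<ge> 27/100 * q ^ 3"
  proof -
    have "3/2 * (18/100) * q ^ 3 \<le> r * exp (- (8/5)) * q ^ 3"
      using assms exp_numeric_bounds(2) q by (intro mult_right_mono mult_mono) auto
    also have "\<dots> \<le> r * exp (- (8/5)) * exp (- (32/45 * W))"
    proof (intro mult_left_mono)
      have "q ^ 3 = exp (- (14/15 * W))" unfolding q_def exp_of_nat_mult[symmetric] by simp
      also have "\<dots> \<le> exp (- (32/45 * W))" using W by simp
      finally show "q ^ 3 \<le> exp (- (32/45 * W))" .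
    qed (use \<open>r > 0\<close> in auto)
    also have "\<dots> = r * exp (- (32/45 * A))"
      unfolding W_def mult.assoc exp_add[symmetric] by (simp add: field_simps)
    finally show ?thesis by simp
  qed
  have t4: "r * exp (- (7/25 * A)) \<le> 825/1000"
  proof -
    have "r * exp (- (7/25 * A)) \<le> 3/2 * exp (2/9 * W) * exp (- (7/25 * A))"
      using r_le by (intro mult_right_mono) auto
    also have "\<dots> = 3/2 * exp (- (63/100)) * exp (- (13/225 * W))"
      unfolding W_def mult.assoc exp_add[symmetric] by (simp add: field_simps)
    also have "\<dots> \<le> 3/2 * (55/100) * 1"
      using exp_numeric_bounds(3) W by (intro mult_mono) auto
    finally show ?thesis by simp
  qed
  \<comment> \<open>The gain is used only for r \<le> 3; for larger r the decay of q
    suffices.\<close>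
  have gain: "(if r \<le> 3 then 185/1000 else 0) \<le> 6366/10000 * (r\<^sup>2 - 9/8) / r ^ 3"
  proof (cases "r \<le> 3")
    case True
    have "0 \<le> (r - 3/2) * (3 - r)" using assms True by simp
    then have "0 \<le> (r - 3/2) * (3 - r) * (r + 1)" using \<open>r > 0\<close> by simp
    then have "185/1000 * r ^ 3 \<le> 6366/10000 * (r\<^sup>2 - 9/8)"
      using \<open>0 \<le> (r - 3/2) * (3 - r)\<close> assms True by (simp add: power2_eq_square power3_eq_cube field_simps)
    then show ?thesis using True \<open>r > 0\<close> by (simp add: field_simps)
  next
    case False
    then have "9/8 \<le> r\<^sup>2" using \<open>(3/2)\<^sup>2 \<le> r\<^sup>2\<close> by (simp add: power2_eq_square)
    then show ?thesis using False by simp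
  qed
  have main: "1309/1000 * (48/100 * q) - 82/100 * (27/100 * q ^ 3) \<le> (if r \<le> 3 then 41/100 else 16/100)"
  proof (cases "r \<le> 3")
    case True
    \<comment> \<open>This is the tangent line of q^3 at 19/20, near the maximiser of the left-hand
      side.\<close>
    have "0 \<le> (q - 19/20)\<^sup>2 * (q + 19/10)" using q by simp
    then have "27075/10000 * q - 171475/100000 \<le> q ^ 3"
      by (simp add: power2_eq_square power3_eq_cube field_simps)
    then have "1309/1000 * (48/100 * q) - 82/100 * (27/100 * q ^ 3) \<le> 41/100" using q by linarith
    then show ?thesis using True by simp
  next
    case False
    then have "3\<^sup>2 \<le> r\<^sup>2" by (intro power_mono) auto
    \<comment> \<open>Here W is at least 9 - 9/4 = 27/4, and 14/45 of that is 21/10.\<close>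
    then have "q \<le> exp (- (21/10))" by (simp add: q_def W_def A)
    then have "q \<le> 1/4" using exp_numeric_bounds(5) by linarith
    moreover have "0 \<le> q ^ 3" using q by simp
    ultimately have "1309/1000 * (48/100 * q) - 82/100 * (27/100 * q ^ 3) \<le> 16/100" by linarith
    then show ?thesis using False by simp
  qed
  have split: "r * (1309/1000 * a + 1/10 * b) = 1309/1000 * (r * a) + 1/10 * (r * b)" "r * (82/100 * a) = 82/100 * (r * a)" for a b
    by (simp_all add: algebra_simps)
  show ?thesis
  proof (cases "r \<le> 3")
    case True
    then show ?thesis using t1 t2 t3 t4 gain main unfolding split if_P[OF True] by linarith
  next
    case False
    then show ?thesis using t1 t2 t3 t4 gain main unfolding split if_not_P[OF False] by linarith
  qed
qed

text \<open>For K = 3/4 this is the exponent in \<open>norm_char_le\<close>. It is concave for p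
  \<ge> 10/9, so its minimum on an interval lies at an endpoint: 8/15 is the value at 4/3, and 7/25
  is just below the value at pi.\<close>

lemma cubic_exponent_ge:
  fixes p :: real
  shows "4/3 \<le> p \<Longrightarrow> p \<le> 8/3 \<Longrightarrow> 8/15 \<le> p\<^sup>2 / 2 - 3/20 * p ^ 3"
    and "8/3 \<le> p \<Longrightarrow> p \<le> pi \<Longrightarrow> 7/25 \<le> p\<^sup>2 / 2 - 3/20 * p ^ 3"
proof -
  assume p: "4/3 \<le> p" "p \<le> 8/3"
  have "0 \<le> (p - 4/3) * ((8/3 - p) * (p + 2/3) + 8/9)"
    using p by (intro mult_nonneg_nonneg add_nonneg_nonneg) auto
  moreover have "p\<^sup>2 / 2 - 3/20 * p ^ 3 = 8/15 + 3/20 * ((p - 4/3) * ((8/3 - p) * (p + 2/3) + 8/9))"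
    by (simp add: power2_eq_square power3_eq_cube field_simps)
  ultimately show "8/15 \<le> p\<^sup>2 / 2 - 3/20 * p ^ 3" by linarith
next
  assume p: "8/3 \<le> p" "p \<le> pi"
  have "p \<le> 31416/10000" using p pi_approx by simp
  then have "0 \<le> (p - 8/3) * (31416/10000 - p) * (3/20 * p + 37124/100000)"
    using p by simp
  then show "7/25 \<le> p\<^sup>2 / 2 - 3/20 * p ^ 3"
    using p \<open>p \<le> 31416/10000\<close> by (simp add: power2_eq_square power3_eq_cube field_simps)
qed

text \<open>The negated bracket is the Gaussian part, the term with 315/512 the third moment error,
  and the last two terms come from the frequencies above 4/3. Bounding pi by decimals and
  multiplying by sqrt A reduces the claim to \<open>smoothing_terms_numeric\<close>.\<close>

lemma smoothing_terms_nonpos: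
  fixes A :: real
  assumes A: "A \<ge> 9/4"
  shows "- (sqrt (pi / (A / 2)) / 2 - 3/4 / A * exp (- (8/9 * A)) + 2 / pi * (1 / A - 9/8 / A\<^sup>2))
    + 315/512 * (sqrt (pi / (2/5 * A)) / 2 - 4/3 * exp (- (32/45 * A)))
    + 18/5 * (1 - 2 / pi) * exp (- (8/15 * A)) + 1/10 * exp (- (7/25 * A)) \<le> 0"
proof -
  define r where "r = sqrt A"
  have rA: "A = r\<^sup>2" using A by (simp add: r_def)
  have "sqrt ((3/2)\<^sup>2) \<le> sqrt A" using A by (intro real_sqrt_le_mono) (simp add: power2_eq_square)
  then have r: "r \<ge> 3/2" by (simp add: r_def)
  have pi: "pi \<ge> 31415/10000" "pi \<le> 31416/10000" using pi_approx by auto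
  have s1: "sqrt (pi / (A / 2)) / 2 \<ge> 1253/1000 / r"
  proof -
    have "2506/1000 \<le> sqrt (2 * pi)" using pi by (intro real_le_rsqrt) (simp add: power2_eq_square)
    then have "1253/1000 / r \<le> sqrt (2 * pi) / 2 / r" using r by (intro divide_right_mono) auto
    moreover have "sqrt (pi / (A / 2)) = sqrt (2 * pi) / r" by (simp add: r_def real_sqrt_divide mult.commute)
    ultimately show ?thesis by simp
  qed
  have s2: "sqrt (pi / (2/5 * A)) / 2 \<le> 14013/10000 / r"
  proof -
    have "sqrt (5/2 * pi) \<le> 28026/10000" using pi by (intro real_le_lsqrt) (simp_all add: power2_eq_square)
    then have "sqrt (5/2 * pi) / 2 / r \<le> 14013/10000 / r" using r by (intro divide_right_mono) auto
    moreover have "pi / (2/5 * A) = 5/2 * pi / A" by simp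
    then have "sqrt (pi / (2/5 * A)) = sqrt (5/2 * pi) / r" by (simp only: r_def real_sqrt_divide)
    ultimately show ?thesis by simp
  qed
  have s3: "6366/10000 \<le> 2 / pi" using pi by (simp add: field_simps)
  have s4: "1 / A - 9/8 / A\<^sup>2 = (r\<^sup>2 - 9/8) / r ^ 3 / r"
    using r by (simp add: rA field_simps eval_nat_numeral)
  have "9/8 \<le> r\<^sup>2" using A rA by simp
  have "6366/10000 * ((r\<^sup>2 - 9/8) / r ^ 3) \<le> 2 / pi * ((r\<^sup>2 - 9/8) / r ^ 3)"
    using s3 r \<open>9/8 \<le> r\<^sup>2\<close> by (intro mult_right_mono) auto
  then have "6366/10000 * ((r\<^sup>2 - 9/8) / r ^ 3) / r \<le> 2 / pi * ((r\<^sup>2 - 9/8) / r ^ 3) / r"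
    using r by (intro divide_right_mono) auto
  then have s5: "6366/10000 * (r\<^sup>2 - 9/8) / r ^ 3 / r \<le> 2 / pi * (1 / A - 9/8 / A\<^sup>2)"
    unfolding s4 by (simp only: times_divide_eq_right)
  have s6: "18/5 * (1 - 2 / pi) * exp (- (8/15 * A)) \<le> 1309/1000 * exp (- (8/15 * A))"
    using s3 by (intro mult_right_mono) auto
  define e1 where "e1 = exp (- (8/9 * A))"
  define e2 where "e2 = exp (- (8/15 * A))"
  define e3 where "e3 = exp (- (7/25 * A))"
  define e4 where "e4 = exp (- (32/45 * A))"
  have "(3/4 / r * e1 + r * (1309/1000 * e2 + 1/10 * e3)) / r
    \<le> (3905/10000 + 6366/10000 * (r\<^sup>2 - 9/8) / r ^ 3 + r * (82/100 * e4)) / r"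
    unfolding e1_def e2_def e3_def e4_def
    using smoothing_terms_numeric[OF r rA] r by (intro divide_right_mono) auto
  then have f: "3/4 / A * e1 + (1309/1000 * e2 + 1/10 * e3)
    \<le> 3905/10000 / r + 6366/10000 * (r\<^sup>2 - 9/8) / r ^ 3 / r + 82/100 * e4"
    using r by (simp add: add_divide_distrib rA power2_eq_square)
  \<comment> \<open>The leading gain minus the leading loss, rounded down.\<close>
  have slack: "3905/10000 / r \<le> 1253/1000 / r - 315/512 * (14013/10000 / r)"
    using r by (simp add: field_simps)
  have "- (a - t + g) + 315/512 * (b - 4/3 * e4) + h + 1/10 * e3 \<le> 0"
    if "t + (1309/1000 * e2 + 1/10 * e3) \<le> q + l + 82/100 * e4" "0 \<le> e4"
      "q \<le> c - 315/512 * d" "c \<le> a" "b \<le> d" "l \<le> g" "h \<le> 1309/1000 * e2"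
    for a b c d g h l q t
    using that by (simp add: field_simps)
  from this[OF f _ slack s1 s2 s5 s6[folded e2_def]] show ?thesis
    unfolding e1_def e2_def e3_def e4_def by simp
qed

section \<open>Integration over the three frequency ranges\<close>

lemma (in centered_third_moment) prob_gt_le_half:
  assumes K: "K = 3/4" and N: "real_distribution N" and int: "integrable N (\<lambda>x. x)"
    and char: "\<And>u. char N u = char M u ^ n"
    and A: "A = real n * \<sigma>2" "A \<ge> 9/4"
  shows "measure N {3/2<..} \<le> 1/2"
proof -
  interpret N: real_distribution N by fact
  define J where "J = N.beurling_expectation (3/2)"
  have J: "J p = Im (char M p ^ n * beurling_weight (3/2) p)" for p
    by (simp add: J_def N.beurling_expectation_eq_Im char)
  have J_int: "J integrable_on {0..pi}"
    unfolding J_def by (rule N.beurling_expectation_integrable[OF int])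
  have pi: "pi \<ge> 31415/10000" "pi \<le> 31416/10000" using pi_approx by auto
  have J_int': "J integrable_on {a..b}" if "0 \<le> a" "b \<le> pi" for a b
    by (rule integrable_on_subinterval[OF J_int]) (use that in auto)
  \<comment> \<open>The error coefficient is 63/128 = 5/24 * 3/4 * 3/2 * 21/10: Gaussian comparison,
    K, missing factor, and weight.\<close>
  define U where "U = (\<lambda>p::real. - (exp (- (A / 2 * p\<^sup>2)) + 2 / pi * (exp (- (A * p\<^sup>2 / 2)) * (p - 9/16 * p ^ 3)))
      + 63/128 * A * (p\<^sup>2 * exp (- (2/5 * A * p\<^sup>2))))"
  have near_0: "J p \<le> U p" if p: "0 < p" "p \<le> 4/3" for p
  proof -
    have "K * p \<le> 1" using p by (simp add: K)
    define g where "g = exp (- (A * p\<^sup>2 / 2))"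
    define w where "w = beurling_weight (3/2) p"
    have "J p = Im (complex_of_real g * w) + Im ((char M p ^ n - complex_of_real g) * w)"
      by (simp add: J w_def left_diff_distrib)
    also have "Im (complex_of_real g * w) = g * Im w" by simp
    also have "g * Im w \<le> g * - (1 + 2 / pi * (p - 9/16 * p ^ 3))"
      unfolding w_def using p by (intro mult_left_mono Im_beurling_weight_le) (auto simp: g_def)
    also have "Im ((char M p ^ n - complex_of_real g) * w) \<le> cmod (char M p ^ n - complex_of_real g) * cmod w"
      using abs_Im_le_cmod[of "(char M p ^ n - complex_of_real g) * w"] by (simp add: norm_mult)
    also have "cmod (char M p ^ n - complex_of_real g) * cmod w \<le> 5 / 24 * (K * A * p ^ 3) * (3 / 2 * exp (- (2 / 5 * A * p\<^sup>2))) * (21/10 / p)"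
      unfolding w_def g_def using p K_pos \<open>K * p \<le> 1\<close> A
      by (intro mult_mono char_power_gaussian_diff_le norm_beurling_weight_near_0) auto
    also have "\<dots> = 63/128 * A * (p\<^sup>2 * exp (- (2/5 * A * p\<^sup>2)))"
      using p by (simp add: K power2_eq_square power3_eq_cube)
    finally show ?thesis by (simp add: U_def g_def algebra_simps)
  qed
  have far: "J p \<le> 27 / (10 * pi) * exp (- (h * A)) * (pi - p)"
    if p: "4/3 \<le> p" "p < pi" and h: "h \<le> p\<^sup>2 / 2 - 3/20 * p ^ 3" for p h
  proof -
    have "J p \<le> cmod (char M p ^ n) * cmod (beurling_weight (3/2) p)"
      unfolding J using abs_Im_le_cmod[of "char M p ^ n * beurling_weight (3/2) p"] by (simp add: norm_mult)
    also have "\<dots> \<le> exp (- (A * (p\<^sup>2 / 2 - K * p ^ 3 / 5))) * (27 / (10 * pi) * (pi - p))"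
      using p A by (intro mult_mono norm_char_power_le norm_beurling_weight_near_pi) auto
    also have "\<dots> \<le> exp (- (h * A)) * (27 / (10 * pi) * (pi - p))"
    proof (rule mult_right_mono)
      have "h * A \<le> (p\<^sup>2 / 2 - 3/20 * p ^ 3) * A" using h A by (intro mult_right_mono) auto
      then show "exp (- (A * (p\<^sup>2 / 2 - K * p ^ 3 / 5))) \<le> exp (- (h * A))" by (simp add: K mult.commute)
    qed (use p in auto)
    finally show ?thesis by (simp only: mult_ac)
  qed
  define I1 where "I1 = integral {0..4/3} (\<lambda>p. exp (- (A / 2 * p\<^sup>2)))"
  define I2 where "I2 = integral {0..4/3} (\<lambda>p. exp (- (2/5 * A * p\<^sup>2)))"
  define I3 where "I3 = exp (- (A * (4/3)\<^sup>2 / 2)) * (- 1 / A + 9/16 * ((4/3)\<^sup>2 / A + 2 / A\<^sup>2)) - (- 1 / A + 9/16 * (2 / A\<^sup>2))"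
  have "(U has_integral - (I1 + 2 / pi * I3) + 63/128 * A * ((I2 - 4/3 * exp (- (2/5 * A * (4/3)\<^sup>2))) / (2 * (2/5 * A)))) {0..4/3}"
    unfolding U_def
  proof (intro has_integral_add has_integral_neg has_integral_mult_right)
    show "((\<lambda>p. exp (- (A / 2 * p\<^sup>2))) has_integral I1) {0..4/3}"
      unfolding I1_def by (intro integrable_integral integrable_continuous_interval continuous_intros)
    show "((\<lambda>p. exp (- (A * p\<^sup>2 / 2)) * (p - 9/16 * p ^ 3)) has_integral I3) {0..4/3}"
      unfolding I3_def by (rule has_integral_gaussian_odd_moments) (use A in auto)
    show "((\<lambda>p. p\<^sup>2 * exp (- (2/5 * A * p\<^sup>2))) has_integral (I2 - 4/3 * exp (- (2/5 * A * (4/3)\<^sup>2))) / (2 * (2/5 * A))) {0..4/3}"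
      unfolding I2_def by (rule has_integral_gaussian_second_moment) (use A in auto)
  qed
  then have b1: "integral {0..4/3} J \<le> - (I1 + 2 / pi * I3) + 63/128 * A * ((I2 - 4/3 * exp (- (2/5 * A * (4/3)\<^sup>2))) / (2 * (2/5 * A)))"
    by (rule integral_le_has_integral_spike[where F = "{0}", rotated]) (use near_0 J_int' pi in auto)
  have b2: "integral {4/3..8/3} J \<le> 27 / (10 * pi) * exp (- (8/15 * A)) * ((pi - 4/3)\<^sup>2 - (pi - 8/3)\<^sup>2) / 2"
  proof (rule integral_le_has_integral_spike[OF J_int' has_integral_const_minus])
    fix p :: real assume "p \<in> {4/3..8/3} - {}"
    then show "J p \<le> 27 / (10 * pi) * exp (- (8/15 * A)) * (pi - p)"
      using pi by (intro far cubic_exponent_ge(1)) auto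
  qed (use pi in auto)
  have b3: "integral {8/3..pi} J \<le> 27 / (10 * pi) * exp (- (7/25 * A)) * ((pi - 8/3)\<^sup>2 - (pi - pi)\<^sup>2) / 2"
  proof (rule integral_le_has_integral_spike[OF J_int' has_integral_const_minus])
    fix p :: real assume "p \<in> {8/3..pi} - {pi}"
    then show "J p \<le> 27 / (10 * pi) * exp (- (7/25 * A)) * (pi - p)"
      by (intro far cubic_exponent_ge(2)) auto
  qed (use pi in auto)
  have I1: "sqrt (pi / (A / 2)) / 2 - 3/4 / A * exp (- (8/9 * A)) \<le> I1"
    using gaussian_truncated_bounds(2)[of "A / 2" "4/3"] A unfolding I1_def by (simp add: power2_eq_square mult.commute)
  have I2: "I2 \<le> sqrt (pi / (2/5 * A)) / 2"
    using gaussian_truncated_bounds(1)[of "2/5 * A" "4/3"] A unfolding I2_def by simp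
  have "A > 0" using A by simp
  have I3: "1 / A - 9/8 / A\<^sup>2 \<le> I3"
  proof -
    \<comment> \<open>Since 9/16 (4/3)^2 = 1, the terms in 1 / A cancel and the boundary term at the
      cut is nonnegative.\<close>
    have "- 1 / A + 9/16 * ((4/3)\<^sup>2 / A + 2 / A\<^sup>2) = 9/8 / A\<^sup>2"
      using A by (simp add: power2_eq_square field_simps)
    then have "0 \<le> exp (- (A * (4/3)\<^sup>2 / 2)) * (- 1 / A + 9/16 * ((4/3)\<^sup>2 / A + 2 / A\<^sup>2))" by simp
    then show ?thesis unfolding I3_def by simp
  qed
  have "63/128 * A * ((I2 - 4/3 * exp (- (2/5 * A * (4/3)\<^sup>2))) / (2 * (2/5 * A))) = 315/512 * (I2 - 4/3 * exp (- (32/45 * A)))"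
    using \<open>A > 0\<close> by (simp add: power2_eq_square field_simps)
  also have "\<dots> \<le> 315/512 * (sqrt (pi / (2/5 * A)) / 2 - 4/3 * exp (- (32/45 * A)))"
    using I2 by simp
  finally have c2: "63/128 * A * ((I2 - 4/3 * exp (- (2/5 * A * (4/3)\<^sup>2))) / (2 * (2/5 * A))) \<le> 315/512 * (sqrt (pi / (2/5 * A)) / 2 - 4/3 * exp (- (32/45 * A)))" .
  have c1: "- (I1 + 2 / pi * I3) \<le> - (sqrt (pi / (A / 2)) / 2 - 3/4 / A * exp (- (8/9 * A)) + 2 / pi * (1 / A - 9/8 / A\<^sup>2))"
    using I1 mult_left_mono[OF I3, of "2 / pi"] by simp
  have c3: "27 / (10 * pi) * exp (- (8/15 * A)) * ((pi - 4/3)\<^sup>2 - (pi - 8/3)\<^sup>2) / 2 = 18/5 * (1 - 2 / pi) * exp (- (8/15 * A))"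
    by (simp add: power2_eq_square field_simps)
  have c4: "27 / (10 * pi) * exp (- (7/25 * A)) * ((pi - 8/3)\<^sup>2 - (pi - pi)\<^sup>2) / 2 \<le> 1/10 * exp (- (7/25 * A))"
  proof -
    have "(pi - 8/3)\<^sup>2 \<le> (475/1000)\<^sup>2" using pi by (intro power_mono) auto
    then have "27 / (10 * pi) * ((pi - 8/3)\<^sup>2 - (pi - pi)\<^sup>2) / 2 \<le> 1/10"
      using pi by (simp add: field_simps)
    then have "27 / (10 * pi) * ((pi - 8/3)\<^sup>2 - (pi - pi)\<^sup>2) / 2 * exp (- (7/25 * A)) \<le> 1/10 * exp (- (7/25 * A))"
      by (intro mult_right_mono) auto
    then show ?thesis by (simp add: mult_ac)
  qed
  have "integral {0..4/3} J + integral {4/3..pi} J = integral {0..pi} J"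
    by (rule Henstock_Kurzweil_Integration.integral_combine) (use J_int pi in auto)
  moreover have "integral {4/3..8/3} J + integral {8/3..pi} J = integral {4/3..pi} J"
    by (rule Henstock_Kurzweil_Integration.integral_combine) (use J_int' pi in auto)
  ultimately have "integral {0..pi} J \<le> 0"
    using b1 b2 b3 c1 c2 c3 c4 smoothing_terms_nonpos[OF A(2)] by linarith
  then have "pi * (2 * N.prob {3/2<..} - 1) \<le> 0"
    using N.prob_le_beurling_expectation[OF int, of "3/2"] by (simp add: J_def)
  then show ?thesis using pi_gt_zero by (simp add: mult_le_0_iff)
qed

section \<open>Sums of independent copies\<close>

text \<open>The mean is carried through the induction because the cross term factors into two
  expectations, both zero.\<close>

lemma (in prob_space) second_moment_sum_indep:
  fixes X :: "'i \<Rightarrow> 'a \<Rightarrow> real"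
  assumes "finite I" "indep_vars (\<lambda>_. borel) X I"
    and "\<And>i. i \<in> I \<Longrightarrow> integrable M (X i)" "\<And>i. i \<in> I \<Longrightarrow> integrable M (\<lambda>\<omega>. (X i \<omega>)\<^sup>2)"
    and "\<And>i. i \<in> I \<Longrightarrow> expectation (X i) = 0"
  shows "integrable M (\<lambda>\<omega>. \<Sum>i\<in>I. X i \<omega>) \<and> integrable M (\<lambda>\<omega>. (\<Sum>i\<in>I. X i \<omega>)\<^sup>2) \<and>
    expectation (\<lambda>\<omega>. \<Sum>i\<in>I. X i \<omega>) = 0 \<and>
    expectation (\<lambda>\<omega>. (\<Sum>i\<in>I. X i \<omega>)\<^sup>2) = (\<Sum>i\<in>I. expectation (\<lambda>\<omega>. (X i \<omega>)\<^sup>2))"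
  using assms
proof (induction I rule: finite_induct)
  case (insert i I)
  let ?S = "\<lambda>\<omega>. \<Sum>i\<in>I. X i \<omega>"
  have "indep_vars (\<lambda>_. borel) X I"
    by (rule indep_vars_subset[OF insert.prems(1)]) auto
  then have IH: "integrable M ?S" "integrable M (\<lambda>\<omega>. (?S \<omega>)\<^sup>2)" "expectation ?S = 0"
    "expectation (\<lambda>\<omega>. (?S \<omega>)\<^sup>2) = (\<Sum>i\<in>I. expectation (\<lambda>\<omega>. (X i \<omega>)\<^sup>2))"
    using insert.IH insert.prems by auto
  have indep: "indep_var borel (X i) borel ?S"
    by (rule indep_vars_sum[OF insert.hyps insert.prems(1)])
  have Xi: "integrable M (X i)" "integrable M (\<lambda>\<omega>. (X i \<omega>)\<^sup>2)" "expectation (X i) = 0"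
    using insert.prems by auto
  have prod: "integrable M (\<lambda>\<omega>. X i \<omega> * ?S \<omega>)" "expectation (\<lambda>\<omega>. X i \<omega> * ?S \<omega>) = 0"
    using indep_var_integrable[OF indep] indep_var_lebesgue_integral[OF indep] Xi IH by auto
  have eq: "(\<lambda>\<omega>. (X i \<omega> + ?S \<omega>)\<^sup>2) = (\<lambda>\<omega>. (X i \<omega>)\<^sup>2 + (?S \<omega>)\<^sup>2 + 2 * (X i \<omega> * ?S \<omega>))"
    by (simp add: power2_sum mult.assoc)
  show ?case
    using Xi IH prod insert.hyps by (simp add: eq)
qed simp

text \<open>The parabola (x + t)^2 is nonnegative, exceeds 4 t^2 for x > t, and has expectation at
  most 2 t^2.\<close>

lemma (in real_distribution) prob_gt_le_half_of_variance_le: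
  assumes "integrable M (\<lambda>x. x)" "integrable M (\<lambda>x. x\<^sup>2)" "expectation (\<lambda>x. x) = 0"
    and "expectation (\<lambda>x. x\<^sup>2) \<le> t\<^sup>2" "t > 0"
  shows "prob {t<..} \<le> 1/2"
proof -
  have indicator_integrable: "integrable M (\<lambda>x. indicator {t<..} x :: real)"
    by (intro integrable_const_bound[of _ 1]) auto
  have "4 * t\<^sup>2 * prob {t<..} = expectation (\<lambda>x. 4 * t\<^sup>2 * indicator {t<..} x)" by simp
  also have "\<dots> \<le> expectation (\<lambda>x. x\<^sup>2 + 2 * t * x + t\<^sup>2)"
  proof (rule integral_mono)
    fix x :: real
    show "4 * t\<^sup>2 * indicator {t<..} x \<le> x\<^sup>2 + 2 * t * x + t\<^sup>2"
    proof (cases "x > t")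
      case True
      then have "(2 * t)\<^sup>2 \<le> (x + t)\<^sup>2" using \<open>t > 0\<close> by (intro power_mono) auto
      then show ?thesis using True by (simp add: power2_sum power_mult_distrib mult_ac)
    next
      case False
      have "0 \<le> (x + t)\<^sup>2" by simp
      then show ?thesis using False by (simp add: power2_sum mult_ac)
    qed
  qed (use assms indicator_integrable in simp_all)
  also have "\<dots> = expectation (\<lambda>x. x\<^sup>2) + t\<^sup>2" using assms prob_space by simp
  also have "\<dots> \<le> 2 * t\<^sup>2" using assms by simp
  finally have "4 * t\<^sup>2 * prob {t<..} \<le> 4 * t\<^sup>2 * (1/2)" by simp
  then show ?thesis using \<open>t > 0\<close> by simp
qed

text \<open>Both alternatives of the hypothesis lead to one inequality between real integrals.
  Integrability is part of the conclusion, since a real integral defaults to 0 without it.\<close>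

lemma third_moment_bound:
  fixes W :: "'a \<Rightarrow> real"
  assumes "prob_space P" and [measurable]: "W \<in> borel_measurable P" and "M > 0"
    and "((\<integral>\<^sup>+ x. ennreal (\<bar>W x\<bar> ^ 3) \<partial>P) \<le> ennreal M * (\<integral>\<^sup>+ x. ennreal ((W x)\<^sup>2) \<partial>P)
           \<and> (\<integral>\<^sup>+ x. ennreal ((W x)\<^sup>2) \<partial>P) < \<infinity>)
         \<or> (AE x in P. \<bar>W x\<bar> \<le> M)"
  shows "integrable P (\<lambda>x. \<bar>W x\<bar> ^ 3) \<and> (\<integral>x. \<bar>W x\<bar> ^ 3 \<partial>P) \<le> M * (\<integral>x. (W x)\<^sup>2 \<partial>P)"
  using assms(4)
proof
  assume *: "(\<integral>\<^sup>+ x. ennreal (\<bar>W x\<bar> ^ 3) \<partial>P) \<le> ennreal M * (\<integral>\<^sup>+ x. ennreal ((W x)\<^sup>2) \<partial>P)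
           \<and> (\<integral>\<^sup>+ x. ennreal ((W x)\<^sup>2) \<partial>P) < \<infinity>"
  have i2: "integrable P (\<lambda>x. (W x)\<^sup>2)"
    using * by (intro integrableI_bounded) auto
  have "(\<integral>\<^sup>+ x. ennreal (\<bar>W x\<bar> ^ 3) \<partial>P) < \<infinity>"
    using * by (auto intro: order_le_less_trans simp: ennreal_mult_less_top)
  then have i3: "integrable P (\<lambda>x. \<bar>W x\<bar> ^ 3)"
    by (intro integrableI_bounded) (auto simp: power_abs)
  have "ennreal (\<integral>x. \<bar>W x\<bar> ^ 3 \<partial>P) \<le> ennreal M * ennreal (\<integral>x. (W x)\<^sup>2 \<partial>P)"
    using * i2 i3 by (simp add: nn_integral_eq_integral)
  also have "\<dots> = ennreal (M * (\<integral>x. (W x)\<^sup>2 \<partial>P))"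
    using \<open>M > 0\<close> by (simp add: ennreal_mult)
  finally show ?thesis
    using i3 \<open>M > 0\<close> by (simp add: ennreal_le_iff)
next
  interpret prob_space P by fact
  assume AE: "AE x in P. \<bar>W x\<bar> \<le> M"
  have i3: "integrable P (\<lambda>x. \<bar>W x\<bar> ^ 3)"
    by (rule integrable_const_bound[of _ "M ^ 3"]) (use AE in \<open>auto intro: power_mono\<close>)
  have i2: "integrable P (\<lambda>x. (W x)\<^sup>2)"
  proof (rule integrable_const_bound[of _ "M\<^sup>2"])
    show "AE x in P. norm ((W x)\<^sup>2) \<le> M\<^sup>2"
      using AE by eventually_elim (simp add: abs_le_square_iff[symmetric])
  qed simp
  have "(\<integral>x. \<bar>W x\<bar> ^ 3 \<partial>P) \<le> (\<integral>x. M * (W x)\<^sup>2 \<partial>P)"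
  proof (rule integral_mono_AE)
    show "AE x in P. \<bar>W x\<bar> ^ 3 \<le> M * (W x)\<^sup>2"
      using AE by eventually_elim (simp add: abs_cube_eq mult_right_mono)
  qed (use i2 i3 in auto)
  then show ?thesis using i3 by simp
qed

theorem theorem1:
  fixes P :: "'a measure" and Q :: "'b measure"
    and W :: "'a \<Rightarrow> real" and X :: "nat \<Rightarrow> 'b \<Rightarrow> real"
    and M :: real and n :: nat
  assumes "prob_space P"
    and "W \<in> borel_measurable P"
    and "integrable P W" and "(\<integral>x. W x \<partial>P) = 0"
    and "M > 0"
    and "((\<integral>\<^sup>+ x. ennreal (\<bar>W x\<bar> ^ 3) \<partial>P) \<le> ennreal M * (\<integral>\<^sup>+ x. ennreal ((W x)\<^sup>2) \<partial>P)
           \<and> (\<integral>\<^sup>+ x. ennreal ((W x)\<^sup>2) \<partial>P) < \<infinity>)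
         \<or> (AE x in P. \<bar>W x\<bar> \<le> M)"
    and "n > 0"
    and "prob_space Q"
    and "prob_space.indep_vars Q (\<lambda>_. borel) X {1..n}"
    and "\<forall>i\<in>{1..n}. distr Q borel (X i) = distr P borel W"
  shows "measure Q {\<omega> \<in> space Q. (\<Sum>i=1..n. X i \<omega>) / real n \<le> 2 * M / real n} \<ge> 1 / 2"
proof -
  note [measurable] = assms(2)
  interpret P: prob_space P by fact
  interpret Q: prob_space Q by fact
  define c where "c = 3 / (4 * M)"
  have c: "c > 0" using \<open>M > 0\<close> by (simp add: c_def)
  \<comment> \<open>\<open>W\<close> and the copies \<open>X i\<close> live on different probability
    spaces and are linked only by their laws, so the moment bounds are stated for the law
    \<open>D\<close>.\<close>
  define D where "D = distr P borel (\<lambda>x. c * W x)"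
  have W3: "integrable P (\<lambda>x. \<bar>W x\<bar> ^ 3)" "(\<integral>x. \<bar>W x\<bar> ^ 3 \<partial>P) \<le> M * (\<integral>x. (W x)\<^sup>2 \<partial>P)"
    using third_moment_bound[OF assms(1,2,5,6)] by auto
  interpret D: centered_third_moment D "3/4"
  proof -
    have "real_distribution D"
      unfolding D_def by (intro P.real_distribution_distr) simp
    moreover have "integrable D (\<lambda>x. \<bar>x\<bar> ^ 3)"
      using W3(1) by (simp add: D_def integrable_distr_eq abs_mult power_mult_distrib)
    moreover have "(\<integral>x. x \<partial>D) = 0"
      using assms(3,4) by (simp add: D_def integral_distr)
    moreover have "(\<integral>x. \<bar>x\<bar> ^ 3 \<partial>D) \<le> 3/4 * (\<integral>x. x\<^sup>2 \<partial>D)"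
    proof -
      have "(\<integral>x. \<bar>x\<bar> ^ 3 \<partial>D) = c ^ 3 * (\<integral>x. \<bar>W x\<bar> ^ 3 \<partial>P)"
        using c by (simp add: D_def integral_distr abs_mult power_mult_distrib)
      also have "\<dots> \<le> c ^ 3 * (M * (\<integral>x. (W x)\<^sup>2 \<partial>P))"
        using W3(2) c by (intro mult_left_mono) auto
      also have "\<dots> = (c * M) * (c\<^sup>2 * (\<integral>x. (W x)\<^sup>2 \<partial>P))"
        by (simp add: power2_eq_square power3_eq_cube)
      also have "c * M = 3/4" using \<open>M > 0\<close> by (simp add: c_def)
      also have "c\<^sup>2 * (\<integral>x. (W x)\<^sup>2 \<partial>P) = (\<integral>x. x\<^sup>2 \<partial>D)"
        by (simp add: D_def integral_distr power_mult_distrib)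
      finally show ?thesis .
    qed
    ultimately show "centered_third_moment D (3/4)"
      by (simp add: centered_third_moment_def centered_third_moment_axioms_def)
  qed
  define Y where "Y i = (\<lambda>\<omega>. c * X i \<omega>)" for i
  have indep: "Q.indep_vars (\<lambda>_. borel) Y {1..n}"
    unfolding Y_def by (rule Q.indep_vars_compose2[OF assms(9)]) simp
  have X_meas [measurable]: "X i \<in> borel_measurable Q" if "i \<in> {1..n}" for i
    using assms(9) that by (simp add: Q.indep_vars_def)
  have Y_meas: "Y i \<in> borel_measurable Q" if "i \<in> {1..n}" for i
    using X_meas[OF that] by (simp add: Y_def)
  have Y_distr: "distr Q borel (Y i) = D" if "i \<in> {1..n}" for i
  proof -
    have "distr Q borel (Y i) = distr (distr Q borel (X i)) borel (\<lambda>x. c * x)"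
      using X_meas[OF that] by (simp add: Y_def distr_distr comp_def)
    also have "\<dots> = D"
      using assms(10) that by (simp add: D_def distr_distr comp_def)
    finally show ?thesis .
  qed
  have Y_int: "integrable Q (\<lambda>\<omega>. f (Y i \<omega>))" "(\<integral>\<omega>. f (Y i \<omega>) \<partial>Q) = (\<integral>x. f x \<partial>D)"
    if "i \<in> {1..n}" "integrable D f" "f \<in> borel_measurable borel" for i and f :: "real \<Rightarrow> real"
    using integrable_distr_eq[OF Y_meas[OF that(1)] that(3)] integral_distr[OF Y_meas[OF that(1)] that(3)] that(2)
    by (simp_all only: Y_distr[OF that(1)])
  define S where "S = (\<lambda>\<omega>. \<Sum>i\<in>{1..n}. Y i \<omega>)"
  have S_meas [measurable]: "S \<in> borel_measurable Q" unfolding S_def using Y_meas by measurable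
  define N where "N = distr Q borel S"
  interpret N: real_distribution N
    unfolding N_def by (intro Q.real_distribution_distr) simp
  define A where "A = real n * (\<integral>x. x\<^sup>2 \<partial>D)"
  have "integrable Q S \<and> integrable Q (\<lambda>\<omega>. (S \<omega>)\<^sup>2) \<and> Q.expectation S = 0 \<and>
      Q.expectation (\<lambda>\<omega>. (S \<omega>)\<^sup>2) = (\<Sum>i\<in>{1..n}. Q.expectation (\<lambda>\<omega>. (Y i \<omega>)\<^sup>2))"
    unfolding S_def
  proof (rule Q.second_moment_sum_indep[OF _ indep])
    fix i assume i: "i \<in> {1..n}"
    show "integrable Q (Y i)" using Y_int(1)[OF i, of "\<lambda>x. x"] by simp
    show "integrable Q (\<lambda>\<omega>. (Y i \<omega>)\<^sup>2)" using Y_int(1)[OF i, of "\<lambda>x. x\<^sup>2"] by simp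
    show "Q.expectation (Y i) = 0" using Y_int(2)[OF i, of "\<lambda>x. x"] D.mean_zero by simp
  qed simp
  then have S: "integrable N (\<lambda>x. x)" "integrable N (\<lambda>x. x\<^sup>2)" "N.expectation (\<lambda>x. x) = 0" "N.expectation (\<lambda>x. x\<^sup>2) = A"
    by (simp_all add: N_def integrable_distr_eq integral_distr A_def Y_int(2)[of _ "\<lambda>x. x\<^sup>2"])
  have tail: "N.prob {3/2<..} \<le> 1/2"
  proof (cases "A \<ge> 9/4")
    case True
    have "char N u = char D u ^ n" for u
    proof -
      have "char N u = (\<Prod>i\<in>{1..n}. char (distr Q borel (Y i)) u)"
        unfolding N_def S_def by (rule Q.char_distr_sum[OF indep])
      then show ?thesis using Y_distr by simp
    qed
    with True show ?thesis
      by (intro D.prob_gt_le_half[of N n A]) (auto simp: A_def S N.real_distribution_axioms)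
  next
    case False
    then have "A \<le> (3/2)\<^sup>2" by (simp add: power2_eq_square)
    then show ?thesis
      by (intro N.prob_gt_le_half_of_variance_le) (simp_all add: S)
  qed
  have "{\<omega> \<in> space Q. (\<Sum>i=1..n. X i \<omega>) / real n \<le> 2 * M / real n} = space Q - (S -` {3/2<..} \<inter> space Q)"
  proof -
    have "(\<Sum>i=1..n. X i \<omega>) / real n \<le> 2 * M / real n \<longleftrightarrow> S \<omega> \<le> 3/2" for \<omega>
    proof -
      have "(\<Sum>i=1..n. X i \<omega>) / real n \<le> 2 * M / real n \<longleftrightarrow> (\<Sum>i=1..n. X i \<omega>) \<le> 2 * M"
        using \<open>n > 0\<close> by (simp add: divide_le_cancel)
      also have "\<dots> \<longleftrightarrow> c * (\<Sum>i=1..n. X i \<omega>) \<le> c * (2 * M)" using c by simp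
      also have "c * (\<Sum>i=1..n. X i \<omega>) = S \<omega>" by (simp add: S_def Y_def sum_distrib_left)
      also have "c * (2 * M) = 3/2" using \<open>M > 0\<close> by (simp add: c_def)
      finally show ?thesis .
    qed
    then show ?thesis by auto
  qed
  then have "Q.prob {\<omega> \<in> space Q. (\<Sum>i=1..n. X i \<omega>) / real n \<le> 2 * M / real n} = 1 - Q.prob (S -` {3/2<..} \<inter> space Q)"
    by (simp add: Q.prob_compl)
  also have "Q.prob (S -` {3/2<..} \<inter> space Q) = N.prob {3/2<..}"
    by (simp add: N_def measure_distr)
  finally show ?thesis using tail by simp
qed

end
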